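(* Let $r\geq 2$ be an integer, let $n$ be a positive integer and let $c$ be a real number with $2/\ln n\leq c\leq r^{-(r+7)(r+1)}$. Let $G$ be a graph of order $n$ with exactly $t_r(n)+1$ edges. Then $G$ contains a (not necessarily induced) subgraph isomorphic to $K_r^+\left(\lfloor c\ln n\rfloor,\ldots,\lfloor c\ln n\rfloor,\lceil n^{1-\sqrt{c}}\rceil\right)$, where the first $r-1$ parts have size $\lfloor c\ln n\rfloor$ and the last part has size $\lceil n^{1-\sqrt{c}}\rceil$.
   Context: $t_r(n)$ denotes the number of edges of the $r$-partite Turán graph of order $n$ (the complete $r$-partite graph on $n$ vertices with part sizes as equal as possible). For integers $s_1\geq 2,s_2,\ldots,s_r\geq 1$, $K_r^+(s_1,\ldots,s_r)$ denotes the complete $r$-partite graph with parts of sizes $s_1,\ldots,s_r$ together with one additional edge joining two vertices of the first part (the part of size $s_1$). *)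

theory Defs
  imports Complex_Main
begin

type_synonym 'a sgraph = "'a set \<times> 'a set set"

abbreviation verts :: "'a sgraph \<Rightarrow> 'a set" where
  "verts G \<equiv> fst G"

abbreviation edges :: "'a sgraph \<Rightarrow> 'a set set" where
  "edges G \<equiv> snd G"

definition simple_graph :: "'a sgraph \<Rightarrow> bool" where
  "simple_graph G \<longleftrightarrow> finite (verts G) \<and> (\<forall>e\<in>edges G. e \<subseteq> verts G \<and> card e = 2)"

definition subgraph_of :: "'a sgraph \<Rightarrow> 'a sgraph \<Rightarrow> bool" where
  "subgraph_of H G \<longleftrightarrow> simple_graph H \<and> verts H \<subseteq> verts G \<and> edges H \<subseteq> edges G"

definition graph_isomorphic :: "'a sgraph \<Rightarrow> 'b sgraph \<Rightarrow> bool" where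
  "graph_isomorphic G H \<longleftrightarrow>
     (\<exists>f. bij_betw f (verts G) (verts H) \<and>
          (\<forall>u\<in>verts G. \<forall>v\<in>verts G. {u, v} \<in> edges G \<longleftrightarrow> {f u, f v} \<in> edges H))"

definition contains_copy :: "'a sgraph \<Rightarrow> 'b sgraph \<Rightarrow> bool" where
  "contains_copy G H \<longleftrightarrow> (\<exists>H'. subgraph_of H' G \<and> graph_isomorphic H H')"

text \<open>The parts are indexed by \<open>0, \<dots>, r - 1\<close>; vertex \<open>(i, j)\<close> is the \<open>j\<close>-th vertex of part \<open>i\<close>,
  which has size \<open>s i\<close>.\<close>

definition complete_multipartite :: "nat \<Rightarrow> (nat \<Rightarrow> nat) \<Rightarrow> (nat \<times> nat) sgraph" where
  "complete_multipartite r s =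
     (let V = (SIGMA i:{..<r}. {..<s i})
      in (V, {{u, v} | u v. u \<in> V \<and> v \<in> V \<and> fst u \<noteq> fst v}))"

text \<open>For \<open>i < r\<close> the numbers \<open>(n + i) div r\<close> differ by at most one, and they sum to \<open>n\<close>
  (Hermite's identity, lemma \<open>card_verts_turan_graph\<close> below).\<close>

definition turan_graph :: "nat \<Rightarrow> nat \<Rightarrow> (nat \<times> nat) sgraph" where
  "turan_graph r n = complete_multipartite r (\<lambda>i. (n + i) div r)"

definition turan_number :: "nat \<Rightarrow> nat \<Rightarrow> nat" where
  "turan_number r n = card (edges (turan_graph r n))"

text \<open>The extra edge lies in part \<open>0\<close>; this is the intended graph only when \<open>r \<ge> 1\<close> and
  \<open>s 0 \<ge> 2\<close>.\<close>

definition K_plus :: "nat \<Rightarrow> (nat \<Rightarrow> nat) \<Rightarrow> (nat \<times> nat) sgraph" where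
  "K_plus r s =
     (verts (complete_multipartite r s),
      insert {(0, 0), (0, 1)} (edges (complete_multipartite r s)))"

lemma simple_graph_complete_multipartite: "simple_graph (complete_multipartite r s)"
  by (auto simp: simple_graph_def complete_multipartite_def Let_def card_2_iff)

lemma simple_graph_K_plus:
  assumes "r \<ge> 1" "s 0 \<ge> 2"
  shows "simple_graph (K_plus r s)"
  using assms simple_graph_complete_multipartite[of r s]
  by (auto simp: simple_graph_def K_plus_def complete_multipartite_def Let_def)

lemma sum_turan_parts:
  fixes r n :: nat
  assumes "r \<ge> 1"
  shows "(\<Sum>i<r. (n + i) div r) = n"
proof (induction n)
  case 0
  show ?case by simp
next
  case (Suc n)
  obtain k where k: "r = Suc k" using assms by (cases r) auto
  have "(\<Sum>i<r. (Suc n + i) div r) = (\<Sum>i<k. (n + Suc i) div r) + (n + r) div r"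
    by (simp add: k)
  also have "(n + r) div r = n div r + 1"
    using assms by simp
  also have "(\<Sum>i<k. (n + Suc i) div r) + (n div r + 1) = (\<Sum>i<r. (n + i) div r) + 1"
    unfolding k by (subst sum.lessThan_Suc_shift) simp
  finally show ?case using Suc by simp
qed

lemma card_verts_turan_graph:
  assumes "r \<ge> 1"
  shows "card (verts (turan_graph r n)) = n"
  using sum_turan_parts[OF assms, of n]
  by (simp add: turan_graph_def complete_multipartite_def Let_def)

end

theory Submission
  imports Defs
begin

text \<open>
  Choose \<open>U\<close> maximising \<open>2 e(U) - \<lambda> |U|\<^sup>2\<close> with \<open>\<lambda>\<close> slightly below \<open>1 - 1/r\<close>.  Then \<open>|U| \<ge> n / (4 r)\<close>,
  every vertex of \<open>U\<close> has at most about \<open>|U| / r\<close> non-neighbours in \<open>U\<close>, and Turan's theorem still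
  yields an \<open>(r + 1)\<close>-clique in \<open>U\<close>.  The degree condition lets us replace all but two vertices of
  this clique, one after the other, in linearly many ways each; hence some edge \<open>uv\<close> has a positive
  proportion of all \<open>(r - 1)\<close>-tuples as cliques in its common neighbourhood, and each of those extends
  linearly often to an \<open>r\<close>-clique.  Following Nikiforov, this dense set of \<open>r\<close>-cliques contains a large
  complete \<open>r\<close>-partite graph, built part by part: given \<open>q s\<close> disjoint, mutually completely joined
  \<open>k\<close>-cliques with many extensions each, a pigeonhole argument over the \<open>2\<^bsup>q s\<^esup>\<close> subsets selects \<open>s\<close> of
  them with many common extensions.  Finally \<open>u\<close> and \<open>v\<close> are put into the first part.
\<close>

section \<open>Turan's theorem\<close>

definition ordered_edges :: "('a \<Rightarrow> 'a \<Rightarrow> bool) \<Rightarrow> 'a set \<Rightarrow> ('a \<times> 'a) set" where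
  "ordered_edges E A = {(x, y). x \<in> A \<and> y \<in> A \<and> E x y}"

definition clique :: "('a \<Rightarrow> 'a \<Rightarrow> bool) \<Rightarrow> 'a set \<Rightarrow> bool" where
  "clique E K \<longleftrightarrow> (\<forall>x\<in>K. \<forall>y\<in>K. x \<noteq> y \<longrightarrow> E x y)"

lemma ordered_edges_subset: "ordered_edges E A \<subseteq> A \<times> A"
  by (auto simp: ordered_edges_def)

lemma finite_ordered_edges: "finite A \<Longrightarrow> finite (ordered_edges E A)"
  by (rule finite_subset[OF ordered_edges_subset]) simp

lemma card_ordered_edges_le:
  assumes "finite A"
  shows "card (ordered_edges E A) \<le> (card A)\<^sup>2"
  using card_mono[OF _ ordered_edges_subset, of A E] assms
  by (simp add: card_cartesian_product power2_eq_square)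

lemma int_consecutive_prod_nonneg: "(0::int) \<le> d * (d + 1)"
  by (cases "d \<ge> 0") (auto simp: zero_le_mult_iff)

text \<open>The right-hand side is twice the Turan number when \<open>d = n div r\<close>; keeping \<open>d\<close> free makes the
  induction on \<open>r\<close> immediate, through \<open>(b - d) * (b - d - 1) \<ge> 0\<close> for integers.\<close>

lemma clique_free_edge_bound:
  fixes E :: "'a \<Rightarrow> 'a \<Rightarrow> bool"
  assumes "finite A" "symp E" "irreflp E"
    and "\<nexists>K. K \<subseteq> A \<and> card K = r + 1 \<and> clique E K"
  shows "int (card (ordered_edges E A))
           \<le> (int (card A))\<^sup>2 - (2 * d + 1) * int (card A) + int r * (d * (d + 1))"
  using assms(1,4)
proof (induction r arbitrary: A)
  case 0
  have "A = {}"
  proof (rule ccontr)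
    assume "A \<noteq> {}"
    then obtain x where "x \<in> A" by auto
    then show False using 0(2)
      by (auto simp: clique_def dest!: spec[of _ "{x}"])
  qed
  then show ?case by (simp add: ordered_edges_def)
next
  case (Suc r)
  show ?case
  proof (cases "A = {}")
    case True
    then show ?thesis using int_consecutive_prod_nonneg[of d]
      by (simp add: ordered_edges_def del: mult_eq_0_iff)
  next
    case False
    define N where "N x = {y \<in> A. E x y}" for x
    have finN: "finite (N x)" for x using Suc.prems(1) by (simp add: N_def)
    \<comment> \<open>A vertex of maximum degree. Its neighbourhood has no clique of size
      \<open>r + 1\<close>, so the induction hypothesis applies there; every other edge meets
      \<open>B\<close>, whose vertices have degree at most \<open>card (N v)\<close>.\<close>
    obtain v where v: "v \<in> A" and vmax: "\<And>w. w \<in> A \<Longrightarrow> card (N w) \<le> card (N v)"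
    proof -
      have "Max ((card \<circ> N) ` A) \<in> (card \<circ> N) ` A"
        using Suc.prems(1) False by (intro Max_in) auto
      then obtain v where "v \<in> A" "card (N v) = Max ((card \<circ> N) ` A)" by force
      then show thesis using Suc.prems(1) by (intro that[of v]) (auto intro!: Max_ge)
    qed
    define B where "B = A - N v"
    have NA: "N v \<subseteq> A" by (auto simp: N_def)
    have cardA: "card A = card B + card (N v)"
      unfolding B_def using Suc.prems(1) NA finN[of v]
      by (simp add: card_Diff_subset card_mono)
    have free: "\<nexists>K. K \<subseteq> N v \<and> card K = r + 1 \<and> clique E K"
    proof
      assume "\<exists>K. K \<subseteq> N v \<and> card K = r + 1 \<and> clique E K"
      then obtain K where K: "K \<subseteq> N v" "card K = r + 1" "clique E K" by blast
      have "v \<notin> K" using K(1) \<open>irreflp E\<close> by (auto simp: N_def irreflp_def)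
      moreover have "finite K" using K(1) finN finite_subset by blast
      moreover have "clique E (insert v K)"
        using K(1,3) \<open>symp E\<close> by (auto simp: clique_def N_def dest: sympD)
      moreover have "insert v K \<subseteq> A" using K(1) v NA by auto
      ultimately show False
        using Suc.prems(2) K(2) by (auto dest!: spec[of _ "insert v K"])
    qed
    let ?S = "SIGMA b:B. N b"
    have finB: "finite B" using Suc.prems(1) by (simp add: B_def)
    have sub: "ordered_edges E A \<subseteq> ordered_edges E (N v) \<union> ?S \<union> prod.swap ` ?S"
    proof
      fix p assume "p \<in> ordered_edges E A"
      then obtain x y where p: "p = (x, y)" and xy: "x \<in> A" "y \<in> A" "E x y"
        by (auto simp: ordered_edges_def)
      show "p \<in> ordered_edges E (N v) \<union> ?S \<union> prod.swap ` ?S"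
      proof (cases "x \<in> N v \<and> y \<in> N v")
        case True
        then show ?thesis using xy p by (simp add: ordered_edges_def)
      next
        case False
        then have "(x, y) \<in> ?S \<or> (y, x) \<in> ?S"
          using xy sympD[OF \<open>symp E\<close>] by (auto simp: B_def N_def)
        then show ?thesis using p by (auto simp: image_iff)
      qed
    qed
    have cS: "card ?S \<le> card B * card (N v)"
    proof -
      have "card ?S = (\<Sum>b\<in>B. card (N b))" using finB finN by simp
      also have "\<dots> \<le> (\<Sum>b\<in>B. card (N v))" by (intro sum_mono vmax) (auto simp: B_def)
      finally show ?thesis by simp
    qed
    have "card (ordered_edges E A) \<le> card (ordered_edges E (N v) \<union> ?S \<union> prod.swap ` ?S)"
      using finB finN by (intro card_mono[OF _ sub]) (auto simp: finite_ordered_edges)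
    also have "\<dots> \<le> card (ordered_edges E (N v)) + card ?S + card (prod.swap ` ?S)"
      by (meson add_le_mono card_Un_le le_refl order_trans)
    also have "card (prod.swap ` ?S) = card ?S" by (rule card_image) (auto simp: inj_on_def)
    finally have "card (ordered_edges E A) \<le> card (ordered_edges E (N v)) + 2 * (card B * card (N v))"
      using cS by linarith
    then have "int (card (ordered_edges E A))
        \<le> int (card (ordered_edges E (N v))) + 2 * (int (card B) * int (card (N v)))"
      by (subst (asm) of_nat_le_iff[where 'a = int, symmetric]) simp
    moreover have "int (card (ordered_edges E (N v)))
        \<le> (int (card (N v)))\<^sup>2 - (2 * d + 1) * int (card (N v)) + int r * (d * (d + 1))"
      by (rule Suc.IH[OF finN free])
    moreover have "0 \<le> (int (card B) - d - 1) * ((int (card B) - d - 1) + 1)"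
      by (rule int_consecutive_prod_nonneg)
    ultimately show ?thesis unfolding cardA
      by (simp add: algebra_simps power2_eq_square)
  qed
qed

lemma card_ordered_edges_graph:
  assumes "simple_graph G"
  shows "card (ordered_edges (\<lambda>x y. {x, y} \<in> edges G) (verts G)) = 2 * card (edges G)"
proof -
  let ?P = "ordered_edges (\<lambda>x y. {x, y} \<in> edges G) (verts G)"
  let ?f = "\<lambda>(x, y). {x, y}"
  have finE: "finite (edges G)"
  proof (rule finite_subset)
    show "edges G \<subseteq> Pow (verts G)" "finite (Pow (verts G))"
      using assms by (auto simp: simple_graph_def)
  qed
  have finP: "finite ?P" using assms by (simp add: simple_graph_def finite_ordered_edges)
  have fib: "card {p \<in> ?P. ?f p = e} = 2" if "e \<in> edges G" for e
  proof -
    have "card e = 2" "e \<subseteq> verts G" using assms that by (auto simp: simple_graph_def)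
    then obtain x y where e: "e = {x, y}" "x \<noteq> y" "x \<in> verts G" "y \<in> verts G"
      by (auto simp: card_2_iff)
    have "{y, x} \<in> edges G" using that e(1) by (simp add: insert_commute)
    with e have "{p \<in> ?P. ?f p = e} = {(x, y), (y, x)}"
      using that by (auto simp: ordered_edges_def doubleton_eq_iff)
    then show ?thesis using e(2) by simp
  qed
  have "card ?P = (\<Sum>e\<in>edges G. card {p \<in> ?P. ?f p = e})"
    unfolding card_eq_sum using finP finE
    by (subst sum.group[of ?P "edges G" ?f]) (auto simp: ordered_edges_def)
  also have "\<dots> = 2 * card (edges G)" by (simp add: fib)
  finally show ?thesis .
qed

text \<open>Count the ordered pairs inside a common part, diagonal included: they number the sum of
  the squares of the \<open>s i\<close>. As \<open>s i\<close> is \<open>d\<close> or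
  \<open>d + 1\<close> with \<open>d = n div r\<close>, the identity
  \<open>(s i - d) * (s i - d - 1) = 0\<close> makes each square linear in \<open>s i\<close>, and
  the \<open>s i\<close> sum to \<open>n\<close>.\<close>

lemma two_turan_number:
  assumes "r \<ge> 1"
  shows "2 * int (turan_number r n)
    = (int n)\<^sup>2 - (2 * int (n div r) + 1) * int n + int r * (int (n div r) * (int (n div r) + 1))"
proof -
  define s where "s i = (n + i) div r" for i
  let ?d = "int (n div r)"
  let ?G = "complete_multipartite r s"
  let ?V = "SIGMA i:{..<r}. {..<s i}"
  have V: "verts ?G = ?V" by (simp add: complete_multipartite_def Let_def)
  have adj: "{x, y} \<in> edges ?G \<longleftrightarrow> fst x \<noteq> fst y" if "x \<in> ?V" "y \<in> ?V" for x y
  proof -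
    have "edges ?G = {{u, v} | u v. u \<in> ?V \<and> v \<in> ?V \<and> fst u \<noteq> fst v}"
      by (simp add: complete_multipartite_def Let_def)
    then show ?thesis using that by (auto simp only: doubleton_eq_iff mem_Collect_eq)
  qed
  have sums: "(\<Sum>i<r. s i) = n" using sum_turan_parts[OF assms, of n] by (simp add: s_def)
  let ?D = "SIGMA x:?V. {fst x} \<times> {..<s (fst x)}"
  let ?P = "ordered_edges (\<lambda>x y. {x, y} \<in> edges ?G) ?V"
  have "?V \<times> ?V = ?P \<union> ?D" "?P \<inter> ?D = {}"
    using adj by (auto simp: ordered_edges_def)
  moreover have fin: "finite ?V" "finite ?P" "finite ?D" by (auto intro: finite_ordered_edges)
  ultimately have "card (?V \<times> ?V) = card ?P + card ?D"
    by (simp only: card_Un_disjoint)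
  moreover have "card ?D = (\<Sum>i<r. s i * s i)"
  proof -
    have "card ?D = (\<Sum>x\<in>?V. s (fst x))" using fin by (simp add: card_SigmaI)
    also have "\<dots> = (\<Sum>i<r. \<Sum>j<s i. s i)" by (subst sum.Sigma) (auto simp: split_def)
    finally show ?thesis by simp
  qed
  moreover have "card ?V = n" using sums by simp
  ultimately have 1: "n * n = card ?P + (\<Sum>i<r. s i * s i)" by (simp add: card_cartesian_product)
  have sq: "int (s i * s i) = (2 * ?d + 1) * int (s i) - ?d * (?d + 1)" if "i < r" for i
  proof -
    have "n div r \<le> s i" unfolding s_def by (intro div_le_mono) simp
    moreover have "s i \<le> (n + r) div r" unfolding s_def using that by (intro div_le_mono) simp
    moreover have "(n + r) div r = n div r + 1" using assms by simp
    ultimately consider "s i = n div r" | "s i = n div r + 1" by linarith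
    then show ?thesis by cases (simp_all add: algebra_simps)
  qed
  have "int (\<Sum>i<r. s i * s i) = (\<Sum>i<r. (2 * ?d + 1) * int (s i) - ?d * (?d + 1))"
    unfolding of_nat_sum using sq by (intro sum.cong) auto
  also have "\<dots> = (2 * ?d + 1) * int n - int r * (?d * (?d + 1))"
    unfolding sums[symmetric] by (simp add: sum_subtractf sum_distrib_left)
  finally have 2: "int (\<Sum>i<r. s i * s i) = (2 * ?d + 1) * int n - int r * (?d * (?d + 1))" .
  have "turan_number r n = card (edges ?G)"
    by (simp add: turan_number_def turan_graph_def s_def[abs_def])
  then have "card ?P = 2 * turan_number r n"
    using card_ordered_edges_graph[OF simple_graph_complete_multipartite, of r s]
    unfolding V by simp
  then have "int n * int n = 2 * int (turan_number r n) + int (\<Sum>i<r. s i * s i)"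
    using arg_cong[OF 1, of int] by simp
  then show ?thesis using 2 by (simp add: power2_eq_square)
qed

text \<open>With \<open>e = n mod r\<close> the expression is exactly
  \<open>(1 - 1 / r) * n ^ 2 - e * (r - e) / r\<close>, and the subtracted term lies between
  \<open>0\<close> and, crudely, \<open>r\<close>.\<close>

lemma turan_quadratic_bounds:
  fixes r n :: nat
  assumes "r \<ge> 1"
  defines "d \<equiv> int (n div r)"
  defines "t \<equiv> real_of_int ((int n)\<^sup>2 - (2 * d + 1) * int n + int r * (d * (d + 1)))"
  shows "t \<le> (1 - 1 / real r) * (real n)\<^sup>2" and "(1 - 1 / real r) * (real n)\<^sup>2 - real r \<le> t"
proof -
  define x where "x = real (n div r)"
  define e where "e = real (n mod r)"
  have n: "real n = real r * x + e"
    unfolding x_def e_def by (metis mult_div_mod_eq of_nat_add of_nat_mult)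
  have e: "0 \<le> e" "e \<le> real r" unfolding e_def using assms(1) by (auto intro: less_imp_le)
  have t: "t = (real n)\<^sup>2 - (2 * x + 1) * real n + real r * (x * (x + 1))"
    unfolding t_def d_def x_def by simp
  have r: "real r > 0" using assms(1) by simp
  have eq: "t = (1 - 1 / real r) * (real n)\<^sup>2 - e * (real r - e) / real r"
    unfolding t n using r by (simp add: field_simps power2_eq_square)
  have "0 \<le> e * (real r - e) / real r" using e r by simp
  then show "t \<le> (1 - 1 / real r) * (real n)\<^sup>2" unfolding eq by simp
  have "e * (real r - e) \<le> real r * real r" using e by (intro mult_mono) auto
  then have "e * (real r - e) / real r \<le> real r" using r by (simp add: divide_le_eq)
  then show "(1 - 1 / real r) * (real n)\<^sup>2 - real r \<le> t" unfolding eq by simp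
qed

section \<open>A dense core containing a clique\<close>

text \<open>For a maximiser \<open>U\<close>, deleting \<open>v\<close> cannot gain: it loses twice
  the degree of \<open>v\<close> and saves \<open>l * (2 * card U - 1)\<close>, which bounds the
  degree from below. The non-neighbours counted here include \<open>v\<close> itself.\<close>

lemma exists_potential_maximiser:
  fixes E :: "'a \<Rightarrow> 'a \<Rightarrow> bool" and l :: real
  assumes "finite V" "symp E" "irreflp E"
  obtains U where "U \<subseteq> V"
    and "real (card (ordered_edges E V)) - l * (real (card V))\<^sup>2
           \<le> real (card (ordered_edges E U)) - l * (real (card U))\<^sup>2"
    and "\<And>v. v \<in> U \<Longrightarrow> real (card {x \<in> U. \<not> E v x}) \<le> (1 - l) * real (card U) + l / 2"
proof -
  define f where "f U = real (card (ordered_edges E U)) - l * (real (card U))\<^sup>2" for U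
  have "Max (f ` Pow V) \<in> f ` Pow V" using \<open>finite V\<close> by (intro Max_in) auto
  then obtain U where U: "U \<subseteq> V" "f U = Max (f ` Pow V)" by auto
  have max: "f W \<le> f U" if "W \<subseteq> V" for W
    unfolding U(2) using that \<open>finite V\<close> by (intro Max_ge) auto
  have finU: "finite U" using U(1) \<open>finite V\<close> finite_subset by blast
  show thesis
  proof (rule that[OF U(1)])
    show "real (card (ordered_edges E V)) - l * (real (card V))\<^sup>2
           \<le> real (card (ordered_edges E U)) - l * (real (card U))\<^sup>2"
      using max[of V] by (simp add: f_def)
  next
    fix v assume v: "v \<in> U"
    let ?N = "{x \<in> U. E v x}"
    have split: "ordered_edges E U = ordered_edges E (U - {v}) \<union> ({v} \<times> ?N \<union> ?N \<times> {v})"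
      using v \<open>symp E\<close> \<open>irreflp E\<close>
      by (auto simp: ordered_edges_def dest: sympD irreflpD)
    have "card (ordered_edges E U) \<le> card (ordered_edges E (U - {v})) + card ({v} \<times> ?N \<union> ?N \<times> {v})"
      unfolding split by (rule card_Un_le)
    also have "card ({v} \<times> ?N \<union> ?N \<times> {v}) \<le> card ({v} \<times> ?N) + card (?N \<times> {v})"
      by (rule card_Un_le)
    also have "\<dots> = 2 * card ?N" by (simp add: card_cartesian_product)
    finally have 1: "real (card (ordered_edges E U))
        \<le> real (card (ordered_edges E (U - {v}))) + 2 * real (card ?N)"
      by linarith
    have cU: "real (card (U - {v})) = real (card U) - 1"
    proof -
      have "0 < card U" using v finU by (auto simp: card_gt_0_iff)
      then show ?thesis using v finU by (simp add: card_Diff_singleton of_nat_diff Suc_leI)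
    qed
    have "f (U - {v}) \<le> f U" using U(1) by (intro max) auto
    then have 2: "l * (2 * real (card U) - 1) \<le> 2 * real (card ?N)"
      using 1 unfolding f_def cU by (simp add: power2_eq_square algebra_simps)
    have "U = ?N \<union> {x \<in> U. \<not> E v x}" by auto
    then have "card U = card ?N + card {x \<in> U. \<not> E v x}"
      using finU card_Un_disjoint[of ?N "{x \<in> U. \<not> E v x}"] by (simp add: disjoint_iff)
    then have "real (card U) = real (card ?N) + real (card {x \<in> U. \<not> E v x})" by linarith
    then show "real (card {x \<in> U. \<not> E v x}) \<le> (1 - l) * real (card U) + l / 2"
      using 2 by (simp add: algebra_simps)
  qed
qed

text \<open>For \<open>l = 1 - 1 / r - e\<close> the whole of \<open>V\<close> has potential at
  least \<open>e * n ^ 2 - r\<close>, while that of \<open>U\<close> is at most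
  \<open>(card U) ^ 2\<close>; so \<open>U\<close> is large. If \<open>U = V\<close>, the single
  edge beyond the Turan number forces the clique. If a vertex was lost, a clique-free
  \<open>U\<close> would have too small a potential.\<close>

lemma exists_dense_core:
  fixes E :: "'a \<Rightarrow> 'a \<Rightarrow> bool" and r n :: nat
  assumes "finite V" "symp E" "irreflp E" "r \<ge> 2" "card V = n"
    and edges: "card (ordered_edges E V) = 2 * (turan_number r n + 1)"
    and large: "real n \<ge> 16 * real r ^ 3"
  obtains U K where "U \<subseteq> V" "real n \<le> 4 * real r * real (card U)"
    and "\<And>v. v \<in> U \<Longrightarrow>
           real (card {x \<in> U. \<not> E v x}) \<le> (1 / real r + 1 / (4 * (real r)\<^sup>2)) * real (card U)"
    and "K \<subseteq> U" "card K = r + 1" "clique E K"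
proof -
  \<comment> \<open>Half of the slack \<open>1 / (4 * r ^ 2)\<close> in the conclusion: one
    \<open>e\<close> comes from \<open>l\<close>, the other absorbs the additive
    \<open>l / 2\<close>. By \<open>large\<close>, also \<open>2 * r \<le> e * n\<close>.\<close>
  define e where "e = 1 / (8 * (real r)\<^sup>2)"
  define l where "l = 1 - 1 / real r - e"
  have r: "real r \<ge> 2" using assms(4) by simp
  have e0: "e > 0" using r by (simp add: e_def)
  have er: "e * real r ^ 2 = 1 / 8" using r by (simp add: e_def)
  have l1: "1 - l = 1 / real r + e" by (simp add: l_def)
  have "1 - l > 0" unfolding l1 using e0 r by (intro add_pos_pos) auto
  then have l2: "l \<le> 1" by simp
  obtain U where U: "U \<subseteq> V"
    and pot: "real (card (ordered_edges E V)) - l * (real (card V))\<^sup>2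
           \<le> real (card (ordered_edges E U)) - l * (real (card U))\<^sup>2"
    and deg: "\<And>v. v \<in> U \<Longrightarrow> real (card {x \<in> U. \<not> E v x}) \<le> (1 - l) * real (card U) + l / 2"
    using exists_potential_maximiser[OF assms(1-3), of l] by blast
  define u where "u = real (card U)"
  have finU: "finite U" using U assms(1) finite_subset by blast
  have "card U \<le> n" using U assms(1,5) card_mono by metis
  have r1: "r \<ge> 1" using assms(4) by simp
  have "(1 - 1 / real r) * (real n)\<^sup>2 - real r \<le> real_of_int (2 * int (turan_number r n))"
    unfolding two_turan_number[OF r1] by (rule turan_quadratic_bounds(2)[OF r1])
  then have EV: "(1 - 1 / real r) * (real n)\<^sup>2 - real r \<le> real (card (ordered_edges E V))"
    using edges by simp
  then have "e * (real n)\<^sup>2 - real r \<le> real (card (ordered_edges E V)) - l * (real (card V))\<^sup>2"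
    unfolding l_def assms(5) by (simp add: algebra_simps)
  also note pot
  also have "real (card (ordered_edges E U)) - l * (real (card U))\<^sup>2 \<le> u\<^sup>2"
  proof -
    have "e \<le> 1 / 8" unfolding e_def using r by (simp add: field_simps)
    moreover have "1 / real r \<le> 1 / 2" using r by (simp add: field_simps)
    ultimately have "l \<ge> 0" by (simp add: l_def)
    then have "0 \<le> l * (real (card U))\<^sup>2" by simp
    moreover have "real (card (ordered_edges E U)) \<le> u\<^sup>2"
      using card_ordered_edges_le[OF finU, of E] unfolding u_def
      by (metis of_nat_le_iff of_nat_power)
    ultimately show ?thesis by linarith
  qed
  finally have uu: "e * (real n)\<^sup>2 - real r \<le> u\<^sup>2" .
  have en: "2 * real r \<le> e * real n"
  proof -
    have "e * (16 * real r ^ 3) = 2 * real r"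
      using er by (simp add: power3_eq_cube power2_eq_square)
    moreover have "e * (16 * real r ^ 3) \<le> e * real n"
      using large e0 by (intro mult_left_mono) auto
    ultimately show ?thesis by linarith
  qed
  have "real r ^ 3 \<ge> 1" using r by simp
  then have n1: "real n \<ge> 1" using large by linarith
  have unbig: "real n \<le> 4 * real r * u"
  proof -
    have "(2 * real r) * 1 \<le> (e * real n) * real n"
      by (rule mult_mono[OF en n1]) (use e0 in auto)
    then have "e * (real n)\<^sup>2 / 2 \<le> u\<^sup>2" using uu by (simp add: power2_eq_square)
    then have "(real n)\<^sup>2 \<le> (4 * real r * u)\<^sup>2"
      using r by (simp add: e_def field_simps power2_eq_square)
    then show ?thesis by (rule power2_le_imp_le) (simp add: u_def)
  qed
  have eu: "1 / 2 \<le> e * u"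
  proof -
    have "2 * real r \<le> e * (4 * real r * u)"
      using en mult_left_mono[OF unbig, of e] e0 by linarith
    then show ?thesis using r by simp
  qed
  have "\<exists>K. K \<subseteq> U \<and> card K = r + 1 \<and> clique E K"
  proof (rule ccontr)
    assume "\<nexists>K. K \<subseteq> U \<and> card K = r + 1 \<and> clique E K"
    then have T: "int (card (ordered_edges E U))
           \<le> (int (card U))\<^sup>2 - (2 * d + 1) * int (card U) + int r * (d * (d + 1))" for d
      by (rule clique_free_edge_bound[OF finU assms(2,3)])
    show False
    proof (cases "card U = n")
      case True
      then have "U = V" using U assms(1,5) by (simp add: card_subset_eq)
      then have "int (card (ordered_edges E V)) \<le> 2 * int (turan_number r n)"
        using T[of "int (n div r)"] unfolding two_turan_number[OF r1] True by simp
      then show False using edges by simp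
    next
      case False
      then have un: "u \<le> real n - 1" using \<open>card U \<le> n\<close> by (simp add: u_def)
      have "real_of_int (int (card (ordered_edges E U))) \<le> (1 - 1 / real r) * u\<^sup>2"
        unfolding u_def using turan_quadratic_bounds(1)[of r "card U"] assms(4)
          T[of "int (card U div r)"] by linarith
      then have "(1 - 1 / real r) * (real n)\<^sup>2 - real r - l * (real n)\<^sup>2
          \<le> (1 - 1 / real r) * u\<^sup>2 - l * u\<^sup>2"
        using EV pot unfolding u_def assms(5) by linarith
      then have "e * ((real n)\<^sup>2 - u\<^sup>2) \<le> real r"
        unfolding l_def by (simp add: algebra_simps)
      \<comment> \<open>One missing vertex already costs
        \<open>n ^ 2 - (n - 1) ^ 2 = 2 * n - 1\<close>, so \<open>e * n\<close> would be at most
        \<open>r\<close>, against \<open>en\<close>.\<close>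
      moreover have "real n \<le> (real n)\<^sup>2 - u\<^sup>2"
      proof -
        have "u\<^sup>2 \<le> (real n - 1)\<^sup>2" using un by (intro power_mono) (auto simp: u_def)
        then show ?thesis using n1 by (simp add: power2_eq_square algebra_simps)
      qed
      ultimately have "e * real n \<le> real r"
        using e0 by (meson mult_left_mono order_trans less_imp_le)
      then show False using en r by linarith
    qed
  qed
  then obtain K where K: "K \<subseteq> U" "card K = r + 1" "clique E K" by blast
  show thesis
  proof (rule that[OF U _ _ K])
    show "real n \<le> 4 * real r * real (card U)" using unbig by (simp add: u_def)
    fix v assume "v \<in> U"
    then have "real (card {x \<in> U. \<not> E v x}) \<le> (1 / real r + e) * u + l / 2"
      using deg l1 by (simp add: u_def)
    also have "\<dots> \<le> (1 / real r + 2 * e) * u" using l2 eu by (simp add: algebra_simps)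
    finally show "real (card {x \<in> U. \<not> E v x}) \<le> (1 / real r + 1 / (4 * (real r)\<^sup>2)) * real (card U)"
      by (simp add: e_def u_def)
  qed
qed

section \<open>An edge in many cliques\<close>

text \<open>A union bound over the non-neighbourhoods. Only an upper bound on \<open>card Y\<close>
  is asked for, so that \<open>Y\<close> may be the set of a list of length
  \<open>k\<close>.\<close>

lemma card_common_neighbours_ge:
  fixes E :: "'a \<Rightarrow> 'a \<Rightarrow> bool" and t :: real
  assumes "finite U" "finite Y" "card Y \<le> k" "t \<ge> 0"
    and "\<And>y. y \<in> Y \<Longrightarrow> real (card {x \<in> U. \<not> E y x}) \<le> t"
  shows "real (card U) - real k * t \<le> real (card {x \<in> U. \<forall>y\<in>Y. E y x})"
proof -
  let ?X = "{x \<in> U. \<forall>y\<in>Y. E y x}"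
  let ?B = "\<Union>y\<in>Y. {x \<in> U. \<not> E y x}"
  have "?X \<union> ?B = U" by auto
  then have "card U \<le> card ?X + card ?B" using card_Un_le[of ?X ?B] by simp
  moreover have "card ?B \<le> (\<Sum>y\<in>Y. card {x \<in> U. \<not> E y x})"
    by (rule card_UN_le[OF assms(2)])
  moreover have "real (\<Sum>y\<in>Y. card {x \<in> U. \<not> E y x}) \<le> real (card Y) * t"
    unfolding of_nat_sum using assms(5) sum_bounded_above[of Y _ t] by simp
  moreover have "real (card Y) * t \<le> real k * t" using assms(3,4) by (simp add: mult_right_mono)
  ultimately show ?thesis by linarith
qed

text \<open>Turns a lower bound on the number of one-vertex extensions into a growth factor for a
  family of lists; \<open>g\<close> prepends or appends the new vertex.\<close>

lemma card_extensions_ge: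
  assumes "finite C" "finite H" "inj_on g (SIGMA y:H. X y)" "\<And>y. y \<in> H \<Longrightarrow> finite (X y)"
    and "\<And>y. y \<in> H \<Longrightarrow> a \<le> real (card (X y))"
    and "\<And>y x. y \<in> H \<Longrightarrow> x \<in> X y \<Longrightarrow> g (y, x) \<in> C"
  shows "real (card H) * a \<le> real (card C)"
proof -
  have "real (card H) * a \<le> (\<Sum>y\<in>H. real (card (X y)))"
    using assms(5) sum_bounded_below[of H a "\<lambda>y. real (card (X y))"] by simp
  also have "\<dots> = real (card (SIGMA y:H. X y))" using assms(2,4) by simp
  also have "card (SIGMA y:H. X y) = card (g ` (SIGMA y:H. X y))"
    using assms(3) by (simp add: card_image)
  also have "real \<dots> \<le> real (card C)"
    using assms(1,6) by (intro of_nat_mono card_mono) auto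
  finally show ?thesis .
qed

text \<open>Ordered cliques, built entry by entry: \<open>sorted_wrt\<close> relates each entry to
  all later ones, so for symmetric irreflexive \<open>E\<close> the entries are distinct and
  pairwise adjacent.\<close>

definition clique_lists :: "('a \<Rightarrow> 'a \<Rightarrow> bool) \<Rightarrow> 'a set \<Rightarrow> nat \<Rightarrow> 'a list set" where
  "clique_lists E U k = {xs. length xs = k \<and> set xs \<subseteq> U \<and> sorted_wrt E xs}"

lemma finite_clique_lists: "finite U \<Longrightarrow> finite (clique_lists E U k)"
  by (rule finite_subset[OF _ finite_lists_length_eq[of U k]]) (auto simp: clique_lists_def)

lemma pigeonhole_card:
  assumes "finite A" "finite B" "\<And>x. x \<in> A \<Longrightarrow> \<exists>y\<in>B. P x y" "A \<noteq> {}"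
  obtains y where "y \<in> B" "card A \<le> card B * card {x \<in> A. P x y}"
proof -
  have "\<exists>y\<in>B. card A \<le> card B * card {x \<in> A. P x y}"
  proof (rule ccontr)
    assume "\<not> ?thesis"
    then have less: "card B * card {x \<in> A. P x y} < card A" if "y \<in> B" for y using that by force
    have "A = (\<Union>y\<in>B. {x \<in> A. P x y})" using assms(3) by auto
    then have "card A \<le> (\<Sum>y\<in>B. card {x \<in> A. P x y})" using card_UN_le[OF assms(2)] by metis
    then have "card B * card A \<le> (\<Sum>y\<in>B. card B * card {x \<in> A. P x y})"
      by (simp flip: sum_distrib_left)
    also have "\<dots> < (\<Sum>y\<in>B. card A)"
    proof (rule sum_strict_mono[OF assms(2)])
      show "B \<noteq> {}" using assms(3,4) by blast
    qed (rule less)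
    finally show False by simp
  qed
  then show thesis using that by blast
qed

text \<open>The vertices of a fixed \<open>(r + 1)\<close>-clique \<open>K\<close> are traded one at a time: an ordered \<open>j\<close>-clique
  joined to \<open>r + 1 - j\<close> vertices of \<open>K\<close> extends to a \<open>(j + 1)\<close>-clique joined to all but one of them
  in linearly many ways.\<close>

definition traded_lists :: "('a \<Rightarrow> 'a \<Rightarrow> bool) \<Rightarrow> 'a set \<Rightarrow> 'a set \<Rightarrow> nat \<Rightarrow> nat \<Rightarrow> 'a list set" where
  "traded_lists E U K p j =
     {ys \<in> clique_lists E U j. \<exists>W\<subseteq>K. card W = p \<and> (\<forall>v\<in>W. \<forall>y\<in>set ys. E v y)}"

text \<open>Let \<open>t\<close> bound the non-neighbours of a vertex. The entries of
  \<open>ys\<close> exclude at most \<open>j * t\<close> candidates. Counting non-adjacent pairs, at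
  most \<open>(r + 1 - j) * t / 2\<close> candidates miss two or more of the
  \<open>r + 1 - j\<close> vertices of \<open>W\<close>; any other one misses at most one, leaving
  \<open>r - j\<close>.\<close>

lemma traded_extensions_ge:
  fixes E :: "'a \<Rightarrow> 'a \<Rightarrow> bool" and r :: nat
  assumes "finite U" "symp E" "r \<ge> 2"
    and deg: "\<And>v. v \<in> U \<Longrightarrow>
           real (card {x \<in> U. \<not> E v x}) \<le> (1 / real r + 1 / (4 * (real r)\<^sup>2)) * real (card U)"
    and K: "K \<subseteq> U"
    and j: "j + 2 \<le> r" and ys: "ys \<in> traded_lists E U K (r + 1 - j) j"
  shows "real (r - 1 - j) / (4 * real r) * real (card U)
           \<le> real (card {x \<in> U. x # ys \<in> traded_lists E U K (r - j) (j + 1)})"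
proof -
  define t where "t = (1 / real r + 1 / (4 * (real r)\<^sup>2)) * real (card U)"
  obtain W where W: "W \<subseteq> K" "card W = r + 1 - j" "\<And>v y. v \<in> W \<Longrightarrow> y \<in> set ys \<Longrightarrow> E v y"
    and cl: "ys \<in> clique_lists E U j"
    using ys by (auto simp: traded_lists_def)
  have len: "length ys = j" "set ys \<subseteq> U" "sorted_wrt E ys" using cl by (auto simp: clique_lists_def)
  have t0: "t \<ge> 0" by (simp add: t_def)
  have finW: "finite W" using W(1) K assms(1) finite_subset by metis
  define X where "X = {x \<in> U. \<forall>y\<in>set ys. E y x}"
  define N where "N x = {v \<in> W. \<not> E v x}" for x
  define B where "B = {x \<in> X. 2 \<le> card (N x)}"
  have fin: "finite X" "finite B" "\<And>x. finite (N x)"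
    using assms(1) finW by (auto simp: X_def B_def N_def)
  have cX: "real (card U) - real j * t \<le> real (card X)"
    unfolding X_def using assms(1) len card_length[of ys] t0 deg
    by (intro card_common_neighbours_ge) (auto simp: t_def)
  have cB: "2 * real (card B) \<le> real (r + 1 - j) * t"
  proof -
    have "2 * card B \<le> (\<Sum>x\<in>B. card (N x))"
      using sum_bounded_below[of B 2 "\<lambda>x. card (N x)"] by (simp add: B_def mult.commute)
    also have "\<dots> = card (SIGMA x:B. N x)" using fin by simp
    also have "\<dots> \<le> card (prod.swap ` (SIGMA v:W. {x \<in> U. \<not> E v x}))"
      using finW assms(1)
      by (intro card_mono) (auto simp: B_def N_def X_def image_iff)
    also have "\<dots> = card (SIGMA v:W. {x \<in> U. \<not> E v x})"
      by (rule card_image) (auto simp: inj_on_def)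
    also have "\<dots> = (\<Sum>v\<in>W. card {x \<in> U. \<not> E v x})" using finW assms(1) by simp
    finally have "real (2 * card B) \<le> real (\<Sum>v\<in>W. card {x \<in> U. \<not> E v x})"
      by (rule of_nat_mono)
    then have "2 * real (card B) \<le> (\<Sum>v\<in>W. real (card {x \<in> U. \<not> E v x}))" by simp
    also have "\<dots> \<le> real (card W) * t"
      using deg W(1) K by (intro sum_bounded_above) (auto simp: t_def)
    finally show ?thesis unfolding W(2) .
  qed
  have sub: "X - B \<subseteq> {x \<in> U. x # ys \<in> traded_lists E U K (r - j) (j + 1)}"
  proof
    fix x assume x: "x \<in> X - B"
    then have "card (N x) \<le> 1" "x \<in> U" by (auto simp: B_def X_def)
    have "r - j \<le> card (W - N x)"
      using W(2) \<open>card (N x) \<le> 1\<close> diff_card_le_card_Diff[OF fin(3), of W x] by linarith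
    then obtain W' where W': "W' \<subseteq> W - N x" "card W' = r - j"
      by (meson obtain_subset_with_card_n)
    have "x # ys \<in> clique_lists E U (j + 1)"
      using x len sympD[OF assms(2)] by (auto simp: clique_lists_def X_def)
    moreover have "W' \<subseteq> K" "\<forall>v\<in>W'. \<forall>y\<in>set (x # ys). E v y"
      using W'(1) W(1,3) by (auto simp: N_def)
    ultimately have "x # ys \<in> traded_lists E U K (r - j) (j + 1)"
      using W'(2) unfolding traded_lists_def by blast
    then show "x \<in> {x \<in> U. x # ys \<in> traded_lists E U K (r - j) (j + 1)}" using \<open>x \<in> U\<close> by simp
  qed
  have r: "real r \<ge> 2" using assms(3) by simp
  have "real (r - 1 - j) / (4 * real r) * real (card U)
      \<le> real (card U) - real j * t - real (r + 1 - j) * t / 2"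
  proof -
    have nj: "real (r - 1 - j) = real r - 1 - real j" "real (r + 1 - j) = real r + 1 - real j"
      using j by (simp_all add: of_nat_diff)
    have "real j + 2 \<le> real r" using j by linarith
    \<comment> \<open>The loss is \<open>(r + 1 + j) / 2\<close> times
      \<open>1 / r + 1 / (4 * r ^ 2)\<close>. The term \<open>1 / r\<close> leaves
      \<open>(r - 1 - j) / (2 * r)\<close>, and the correction consumes at most half of that because
      \<open>r + 1 + j \<le> 2 * r * (r - 1 - j)\<close>.\<close>
    then have "(real r - 1 - real j) / (4 * real r)
      \<le> 1 - (real j + (real r + 1 - real j) / 2) * (1 / real r + 1 / (4 * (real r)\<^sup>2))"
    proof -
      assume jr: "real j + 2 \<le> real r"
      have "(real r + 1 + real j) \<le> 2 * real r * (real r - 1 - real j)"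
      proof -
        have "2 * real r * 1 \<le> 2 * real r * (real r - 1 - real j)"
          using jr r by (intro mult_left_mono) auto
        then show ?thesis using jr by linarith
      qed
      then have "0 \<le> (2 * real r * (real r - 1 - real j) - (real r + 1 + real j)) / (8 * (real r)\<^sup>2)"
        by simp
      also have "\<dots> = 1 - (real j + (real r + 1 - real j) / 2) * (1 / real r + 1 / (4 * (real r)\<^sup>2))
          - (real r - 1 - real j) / (4 * real r)"
        using r by (simp add: field_simps power2_eq_square)
      finally show ?thesis by simp
    qed
    then have "(real r - 1 - real j) / (4 * real r) * real (card U)
      \<le> (1 - (real j + (real r + 1 - real j) / 2) * (1 / real r + 1 / (4 * (real r)\<^sup>2))) * real (card U)"
      by (rule mult_right_mono) simp
    also have "\<dots> = real (card U) - real j * t - (real r + 1 - real j) * t / 2"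
    proof -
      have "(1 - (a + b / 2) * x) * y = y - a * (x * y) - b * (x * y) / 2" for a b x y :: real
        by (simp add: algebra_simps)
      then show ?thesis unfolding t_def .
    qed
    finally show ?thesis unfolding nj .
  qed
  also have "\<dots> \<le> real (card X) - real (card B)" using cX cB by linarith
  also have "\<dots> \<le> real (card (X - B))"
    using diff_card_le_card_Diff[OF fin(2), of X] by linarith
  also have "\<dots> \<le> real (card {x \<in> U. x # ys \<in> traded_lists E U K (r - j) (j + 1)})"
    using assms(1) sub by (intro of_nat_mono card_mono) auto
  finally show ?thesis .
qed

text \<open>Starts from the empty list, to which all of \<open>K\<close> is joined, and trades one
  vertex per step; at \<open>j = r - 1\<close> two vertices of \<open>K\<close> remain.\<close>

lemma card_traded_lists_ge:
  fixes E :: "'a \<Rightarrow> 'a \<Rightarrow> bool" and r :: nat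
  assumes "finite U" "symp E" "r \<ge> 2"
    and deg: "\<And>v. v \<in> U \<Longrightarrow>
           real (card {x \<in> U. \<not> E v x}) \<le> (1 / real r + 1 / (4 * (real r)\<^sup>2)) * real (card U)"
    and K: "K \<subseteq> U" "card K = r + 1"
    and j: "j + 1 \<le> r"
  shows "(\<Prod>i<j. real (r - 1 - i) / (4 * real r) * real (card U))
           \<le> real (card (traded_lists E U K (r + 1 - j) j))"
  using j
proof (induction j)
  case 0
  have "[] \<in> traded_lists E U K (r + 1 - 0) 0"
    using K(2) by (auto simp: traded_lists_def clique_lists_def)
  moreover have "finite (traded_lists E U K (r + 1 - 0) 0)"
    using finite_clique_lists[OF assms(1)] by (simp add: traded_lists_def)
  ultimately have "1 \<le> card (traded_lists E U K (r + 1 - 0) 0)"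
    by (metis One_nat_def Suc_leI card_gt_0_iff empty_iff)
  then show ?case by simp
next
  case (Suc j)
  let ?a = "real (r - 1 - j) / (4 * real r) * real (card U)"
  have fin: "finite (traded_lists E U K p i)" for p i
    using finite_clique_lists[OF assms(1)] by (simp add: traded_lists_def)
  have "(\<Prod>i<Suc j. real (r - 1 - i) / (4 * real r) * real (card U))
      = (\<Prod>i<j. real (r - 1 - i) / (4 * real r) * real (card U)) * ?a" by simp
  also have "\<dots> \<le> real (card (traded_lists E U K (r + 1 - j) j)) * ?a"
    using Suc by (intro mult_right_mono) auto
  also have "\<dots> \<le> real (card (traded_lists E U K (r - j) (j + 1)))"
  proof (rule card_extensions_ge[OF fin fin, where g = "\<lambda>(ys, x). x # ys"])
    show "inj_on (\<lambda>(ys, x). x # ys) (SIGMA ys:traded_lists E U K (r + 1 - j) j.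
            {x \<in> U. x # ys \<in> traded_lists E U K (r - j) (j + 1)})"
      by (auto simp: inj_on_def)
    fix ys assume "ys \<in> traded_lists E U K (r + 1 - j) j"
    then show "?a \<le> real (card {x \<in> U. x # ys \<in> traded_lists E U K (r - j) (j + 1)})"
      using Suc.prems by (intro traded_extensions_ge[OF assms(1-4) K(1)]) auto
  qed (use assms(1) in auto)
  finally show ?case by simp
qed

text \<open>The ratio of \<open>4 ^ k\<close> to \<open>fact k\<close> peaks at \<open>k = 3\<close>
  and \<open>k = 4\<close> with the value \<open>32 / 3\<close>; from \<open>k = 3\<close> on the
  factorial gains at least a factor \<open>4\<close> per step.\<close>

lemma four_power_le_fact: "3 * 4 ^ k \<le> 32 * (fact k :: real)"
proof -
  consider "k = 0" | "k = 1" | "k = 2" | "k \<ge> 3" by linarith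
  then show ?thesis
  proof cases
    case 4
    then show ?thesis
    proof (induction k rule: dec_induct)
      case base
      show ?case by (simp add: fact_numeral)
    next
      case (step k)
      have "3 * 4 ^ Suc k = 4 * (3 * 4 ^ k :: real)" by simp
      also have "\<dots> \<le> real (Suc k) * (32 * fact k)" using step by (intro mult_mono[OF _ step.IH]) auto
      finally show ?case by simp
    qed
  qed (auto simp: fact_numeral)
qed

lemma prod_descending_eq_fact:
  "(\<Prod>i<k. real (k - i) * a) = fact k * a ^ k"
proof (induction k)
  case (Suc k)
  have "(\<Prod>i<Suc k. real (Suc k - i) * a) = real (Suc k) * a * (\<Prod>i<k. real (k - i) * a)"
    by (subst prod.lessThan_Suc_shift) simp
  then show ?case using Suc by simp
qed simp

text \<open>A quantitative form of the Bollobas--Nikiforov theorem on joints: some edge \<open>uv\<close> of \<open>K\<close> lies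
  in many \<open>(r + 1)\<close>-cliques.  The last entry of each list is joined to the other entries, but not
  necessarily to \<open>u\<close> and \<open>v\<close>.\<close>

lemma exists_edge_with_many_cliques:
  fixes E :: "'a \<Rightarrow> 'a \<Rightarrow> bool" and r :: nat
  assumes "finite U" "symp E" "r \<ge> 2"
    and deg: "\<And>v. v \<in> U \<Longrightarrow>
           real (card {x \<in> U. \<not> E v x}) \<le> (1 / real r + 1 / (4 * (real r)\<^sup>2)) * real (card U)"
    and K: "K \<subseteq> U" "card K = r + 1" "clique E K"
  obtains u v F where "u \<in> U" "v \<in> U" "u \<noteq> v" "E u v" "F \<subseteq> clique_lists E U r"
    and "\<And>xs x. xs \<in> F \<Longrightarrow> x \<in> set (butlast xs) \<Longrightarrow> E u x \<and> E v x"
    and "real r * (2 / real r ^ (r + 8)) * real (card U) ^ r \<le> real (card F)"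
proof -
  let ?u = "real (card U)"
  let ?T = "traded_lists E U K 2 (r - 1)"
  let ?P = "\<lambda>ys W. \<forall>v\<in>W. \<forall>y\<in>set ys. E v y"
  have r: "real r \<ge> 2" using assms(3) by simp
  have finK: "finite K" using K(1) assms(1) finite_subset by blast
  have upos: "?u > 0" using K(1,2) assms(1) by (auto simp: card_gt_0_iff)
  have finT: "finite ?T" using finite_clique_lists[OF assms(1)] by (simp add: traded_lists_def)
  have "(\<Prod>i<r-1. real (r - 1 - i) * (?u / (4 * real r))) \<le> real (card ?T)"
    using card_traded_lists_ge[OF assms(1-4) K(1,2), of "r - 1"] assms(3) by simp
  then have T: "fact (r - 1) * (?u / (4 * real r)) ^ (r - 1) \<le> real (card ?T)"
    unfolding prod_descending_eq_fact .
  moreover have "0 < fact (r - 1) * (?u / (4 * real r)) ^ (r - 1)" using upos r by simp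
  ultimately have "?T \<noteq> {}" by force
  let ?B = "{W. W \<subseteq> K \<and> card W = 2}"
  \<comment> \<open>Every traded list is joined to some pair from \<open>K\<close>. There are only
    \<open>r * (r + 1) / 2\<close> pairs, so one of them serves a fixed proportion of the
    lists.\<close>
  obtain W where W: "W \<in> ?B" "card ?T \<le> card ?B * card {ys \<in> ?T. ?P ys W}"
  proof (rule pigeonhole_card[OF finT _ _ \<open>?T \<noteq> {}\<close>, of ?B ?P])
    show "finite ?B" using finK by simp
    show "\<exists>W\<in>?B. ?P ys W" if "ys \<in> ?T" for ys using that by (auto simp: traded_lists_def)
  qed
  define H where "H = {ys \<in> ?T. ?P ys W}"
  have "card ?B = (r + 1) choose 2" using n_subsets[OF finK] K(2) by simp
  then have B: "real (card ?B) = real r * (real r + 1) / 2"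
    by (simp add: choose_two real_of_nat_div algebra_simps)
  obtain u v where uv: "W = {u, v}" "u \<noteq> v" using W(1) by (auto simp: card_2_iff)
  have H: "fact (r - 1) * (?u / (4 * real r)) ^ (r - 1) \<le> real r * (real r + 1) / 2 * real (card H)"
  proof -
    have "real (card ?T) \<le> real (card ?B * card H)" using W(2) unfolding H_def by (rule of_nat_mono)
    then show ?thesis using T unfolding of_nat_mult B by linarith
  qed
  \<comment> \<open>The last vertex is sought among the common neighbours of \<open>ys\<close>
    alone: \<open>r + 1\<close> non-neighbourhoods of relative size about \<open>1 / r\<close> could
    cover \<open>U\<close>, whereas \<open>r - 1\<close> of them leave a fraction of at least
    \<open>1 / (2 * r)\<close>.\<close>
  define X where "X ys = {x \<in> U. \<forall>y\<in>set ys. E y x}" for ys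
  define F where "F = (\<lambda>(ys, x). ys @ [x]) ` (SIGMA ys:H. X ys)"
  have Hcl: "ys \<in> clique_lists E U (r - 1)" if "ys \<in> H" for ys
    using that by (auto simp: H_def traded_lists_def)
  have Fcl: "F \<subseteq> clique_lists E U r"
  proof
    fix zs assume "zs \<in> F"
    then obtain ys x where "zs = ys @ [x]" "ys \<in> H" "x \<in> X ys" by (auto simp: F_def)
    then show "zs \<in> clique_lists E U r"
      using Hcl[of ys] assms(3) by (auto simp: X_def clique_lists_def sorted_wrt_append)
  qed
  have "real (card H) * (?u / (2 * real r)) \<le> real (card F)"
  proof (rule card_extensions_ge[where g = "\<lambda>(ys, x). ys @ [x]"])
    show "finite F" using Fcl finite_clique_lists[OF assms(1)] finite_subset by blast
    show "finite H" using finT by (simp add: H_def)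
    fix ys assume "ys \<in> H"
    then have ys: "length ys = r - 1" "set ys \<subseteq> U" using Hcl by (auto simp: clique_lists_def)
    have "?u / (2 * real r) \<le> ?u - real (r - 1) * ((1 / real r + 1 / (4 * (real r)\<^sup>2)) * ?u)"
    proof -
      have "1 / (2 * real r) \<le> 1 - (real r - 1) * (1 / real r + 1 / (4 * (real r)\<^sup>2))"
        using r by (simp add: field_simps power2_eq_square)
      from mult_right_mono[OF this, of ?u] show ?thesis
        using assms(3) by (simp add: of_nat_diff algebra_simps)
    qed
    also have "\<dots> \<le> real (card (X ys))"
      unfolding X_def using assms(1) ys card_length[of ys] deg
      by (intro card_common_neighbours_ge) auto
    finally show "?u / (2 * real r) \<le> real (card (X ys))" .
  qed (auto simp: inj_on_def X_def F_def assms(1))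
  then have F: "fact (r - 1) * (?u / (4 * real r)) ^ (r - 1) * (?u / (2 * real r))
      \<le> real r * (real r + 1) / 2 * real (card F)"
  proof -
    assume "real (card H) * (?u / (2 * real r)) \<le> real (card F)"
    then have "real r * (real r + 1) / 2 * (real (card H) * (?u / (2 * real r)))
        \<le> real r * (real r + 1) / 2 * real (card F)" using r by (intro mult_left_mono) auto
    moreover have "fact (r - 1) * (?u / (4 * real r)) ^ (r - 1) * (?u / (2 * real r))
      \<le> real r * (real r + 1) / 2 * real (card H) * (?u / (2 * real r))"
      using H r by (intro mult_right_mono) auto
    ultimately show ?thesis by (simp add: mult.assoc)
  qed
  show thesis
  proof (rule that[of u v F])
    show "u \<in> U" "v \<in> U" "u \<noteq> v" "E u v" using uv W(1) K by (auto simp: clique_def)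
    show "F \<subseteq> clique_lists E U r" by (rule Fcl)
    show "E u x \<and> E v x" if "xs \<in> F" "x \<in> set (butlast xs)" for xs x
      using that uv(1) by (auto simp: F_def H_def)
    obtain k where k: "r = Suc k" using assms(3) by (cases r) auto
    \<comment> \<open>After cancelling, the claim becomes
      \<open>(r + 1) / r ^ 6 \<le> fact k / (2 * 4 ^ k)\<close>, whose right side is at least
      \<open>3 / 64\<close> by \<open>four_power_le_fact\<close>.\<close>
    have "64 * (real r + 1) \<le> 3 * real r ^ 6"
    proof -
      have "2 ^ 5 * real r \<le> real r ^ 5 * real r" using r by (intro mult_right_mono power_mono) auto
      then have "32 * real r \<le> real r ^ 6" by (simp add: power_Suc2[symmetric] eval_nat_numeral)
      then have "3 * (32 * real r) \<le> 3 * real r ^ 6" by simp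
      moreover have "64 * (real r + 1) \<le> 3 * (32 * real r)" using r by simp
      ultimately show ?thesis by (rule order_trans[rotated])
    qed
    let ?c = "?u ^ r / real r ^ r"
    have "real r * (2 / real r ^ (r + 8)) * ?u ^ r * (real r * (real r + 1) / 2)
        = (real r + 1) * (?u ^ r / real r ^ (r + 6))"
      using r by (simp add: power_add field_simps eval_nat_numeral)
    also have "\<dots> \<le> (3 * real r ^ 6 / 64) * (?u ^ r / real r ^ (r + 6))"
      using \<open>64 * (real r + 1) \<le> 3 * real r ^ 6\<close> by (intro mult_right_mono) auto
    also have "\<dots> = 3 / 32 * ?c / 2"
      using r by (simp add: power_add)
    also have "\<dots> \<le> fact k / 4 ^ k * ?c / 2"
      using four_power_le_fact[of k] by (intro divide_right_mono mult_right_mono) (auto simp: field_simps)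
    also have "\<dots> = fact (r - 1) * (?u / (4 * real r)) ^ (r - 1) * (?u / (2 * real r))"
    proof -
      have "(?u / (4 * real r)) ^ k = ?u ^ k / (4 ^ k * real r ^ k)"
        by (simp add: power_divide power_mult_distrib)
      moreover have "?u ^ r = ?u * ?u ^ k" "real r ^ r = real r * real r ^ k" "r - 1 = k"
        by (simp_all add: k)
      ultimately show ?thesis using r by (simp add: field_simps)
    qed
    also note F
    finally have "real r * (2 / real r ^ (r + 8)) * ?u ^ r * (real r * (real r + 1) / 2)
       \<le> real (card F) * (real r * (real r + 1) / 2)" by (simp add: mult.commute)
    moreover have "real r * (real r + 1) / 2 > 0" using r by simp
    ultimately show "real r * (2 / real r ^ (r + 8)) * ?u ^ r \<le> real (card F)"
      by (simp only: mult_le_cancel_right_pos)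
  qed
qed

section \<open>Blowing up cliques\<close>

text \<open>Count pairs \<open>(j, y)\<close> with \<open>y\<close> in \<open>N j\<close>: there are
  at least \<open>b * m * card V\<close>. Points lying in fewer than \<open>s\<close> of the sets
  account for at most half of them, so at least \<open>b / 2 * card V\<close> points lie in
  \<open>s\<close> or more. Each of these chooses an \<open>s\<close>-subset of the indices, out of
  at most \<open>2 ^ m\<close>.\<close>

lemma exists_common_block:
  fixes N :: "nat \<Rightarrow> 'a set" and b :: real
  assumes "finite V" "\<And>j. j < m \<Longrightarrow> N j \<subseteq> V"
    and "\<And>j. j < m \<Longrightarrow> b * real (card V) \<le> real (card (N j))"
    and "2 * real s \<le> b * real m" "b > 0" "V \<noteq> {}" "m > 0"
  obtains S where "S \<subseteq> {..<m}" "card S = s"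
    and "b / 2 * real (card V) \<le> 2 ^ m * real (card {y \<in> V. \<forall>j\<in>S. y \<in> N j})"
proof -
  define J where "J y = {j. j < m \<and> y \<in> N j}" for y
  define Y where "Y = {y \<in> V. s \<le> card (J y)}"
  have fin: "finite Y" "\<And>y. finite (J y)" "\<And>j. j < m \<Longrightarrow> finite (N j)"
    using assms(1) finite_subset[OF assms(2)] by (auto simp: Y_def J_def)
  have "real m * (b * real (card V)) \<le> (\<Sum>j<m. real (card (N j)))"
    using assms(3) sum_bounded_below[of "{..<m}" "b * real (card V)" "\<lambda>j. real (card (N j))"] by simp
  also have "\<dots> = real (card (SIGMA j:{..<m}. N j))" using fin by simp
  also have "\<dots> = real (card (SIGMA y:V. J y))"
  proof -
    have "prod.swap ` (SIGMA j:{..<m}. N j) = (SIGMA y:V. J y)"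
      using subsetD[OF assms(2)] by (auto simp: J_def image_iff)
    moreover have "inj_on prod.swap (SIGMA j:{..<m}. N j)" by (auto simp: inj_on_def)
    ultimately show ?thesis by (metis card_image)
  qed
  also have "\<dots> = (\<Sum>y\<in>V. real (card (J y)))" using fin assms(1) by simp
  also have "\<dots> \<le> (\<Sum>y\<in>V. real s + (if y \<in> Y then real m else 0))"
  proof (rule sum_mono)
    fix y assume "y \<in> V"
    moreover have "card (J y) \<le> m" using card_mono[of "{..<m}" "J y"] by (auto simp: J_def)
    ultimately show "real (card (J y)) \<le> real s + (if y \<in> Y then real m else 0)"
      by (auto simp: Y_def)
  qed
  also have "\<dots> = real (card V) * real s + real (card Y) * real m"
  proof -
    have "V \<inter> Y = Y" by (auto simp: Y_def)
    then show ?thesis using assms(1) by (simp add: sum.distrib sum.If_cases)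
  qed
  finally have "real m * (b * real (card V)) \<le> real (card V) * real s + real (card Y) * real m" .
  moreover have "real (card V) * (2 * real s) \<le> real (card V) * (b * real m)"
    using assms(4) by (intro mult_left_mono) auto
  ultimately have "real m * (b / 2 * real (card V)) \<le> real m * real (card Y)"
    by (simp add: algebra_simps)
  then have Y: "b / 2 * real (card V) \<le> real (card Y)" using assms(7) by simp
  have "0 < b / 2 * real (card V)" using assms(1,5,6) by (simp add: card_gt_0_iff)
  then have "Y \<noteq> {}" using Y by force
  let ?B = "{S. S \<subseteq> {..<m} \<and> card S = s}"
  obtain S where S: "S \<in> ?B" "card Y \<le> card ?B * card {y \<in> Y. S \<subseteq> J y}"
  proof (rule pigeonhole_card[OF fin(1) _ _ \<open>Y \<noteq> {}\<close>, of ?B "\<lambda>y S. S \<subseteq> J y"])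
    fix y assume "y \<in> Y"
    then obtain S where "S \<subseteq> J y" "card S = s"
      by (auto simp: Y_def elim: obtain_subset_with_card_n)
    then show "\<exists>S\<in>?B. S \<subseteq> J y" by (auto simp: J_def)
  qed simp
  have "card ?B \<le> card (Pow {..<m})" by (rule card_mono) auto
  then have "card ?B \<le> 2 ^ m" by (simp add: card_Pow)
  moreover have "card {y \<in> Y. S \<subseteq> J y} \<le> card {y \<in> V. \<forall>j\<in>S. y \<in> N j}"
    using assms(1) by (intro card_mono) (auto simp: Y_def J_def)
  ultimately have "card Y \<le> 2 ^ m * card {y \<in> V. \<forall>j\<in>S. y \<in> N j}"
    using S(2) by (meson mult_le_mono order_trans)
  then have "real (card Y) \<le> real (2 ^ m * card {y \<in> V. \<forall>j\<in>S. y \<in> N j})" by (rule of_nat_mono)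
  then show thesis using S(1) Y by (intro that[of S]) auto
qed

text \<open>Lists \<open>D 0, \<dots>, D (s - 1)\<close> whose columns form a complete multipartite graph.  Only the rows
  themselves are required to lie in \<open>F\<close>, which lets the lists be lengthened one entry at a time
  with each part shrinking by a constant factor only.\<close>

definition blow_up :: "('a \<Rightarrow> 'a \<Rightarrow> bool) \<Rightarrow> 'a list set \<Rightarrow> nat \<Rightarrow> nat \<Rightarrow> (nat \<Rightarrow> 'a list) \<Rightarrow> bool" where
  "blow_up E F k s D \<longleftrightarrow>
     (\<forall>j<s. D j \<in> F) \<and>
     (\<forall>p<k. inj_on (\<lambda>j. D j ! p) {..<s}) \<and>
     (\<forall>i<s. \<forall>j<s. \<forall>p<k. \<forall>q<k. p \<noteq> q \<longrightarrow> E (D i ! p) (D j ! q))"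

lemma blow_up_comp:
  assumes "blow_up E F k m D" "inj_on h {..<s}" "h ` {..<s} \<subseteq> {..<m}"
  shows "blow_up E F k s (D \<circ> h)"
proof -
  have h: "h j < m" if "j < s" for j using assms(3) that by auto
  have "inj_on (\<lambda>j. D (h j) ! p) {..<s}" if "p < k" for p
  proof -
    have "inj_on (\<lambda>j. D j ! p) {..<m}" using assms(1) that by (simp add: blow_up_def)
    then have "inj_on ((\<lambda>j. D j ! p) \<circ> h) {..<s}"
      using assms(2,3) by (intro comp_inj_on) (auto intro: inj_on_subset)
    then show ?thesis by (simp add: o_def)
  qed
  then show ?thesis using assms(1) h by (auto simp: blow_up_def)
qed

text \<open>\<open>F'\<close> collects the tails with at least \<open>b * card V\<close> heads. The
  other tails account for at most \<open>b * card V ^ Suc k\<close> lists, so the coefficient only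
  drops from \<open>Suc k\<close> to \<open>k\<close>. Among the \<open>q * s\<close> rows found in
  \<open>F'\<close>, \<open>s\<close> have many common heads \<open>T\<close>. All of
  \<open>T\<close> is returned: the recursion takes \<open>s\<close> of its elements, the last part
  of the final graph far more.\<close>

lemma blow_up_extend:
  fixes b :: real and q s k :: nat
  assumes "finite V" "V \<noteq> {}" "F \<subseteq> clique_lists E V (Suc k)"
    and dense: "real (Suc k) * b * real (card V) ^ Suc k \<le> real (card F)"
    and "b > 0" "2 \<le> real q * b" "s > 0"
    and IH: "\<And>F'. F' \<subseteq> clique_lists E V k \<Longrightarrow> real k * b * real (card V) ^ k \<le> real (card F') \<Longrightarrow>
               \<exists>D. blow_up E F' k (q * s) D"
  obtains F' D T where "F' \<subseteq> clique_lists E V k" "blow_up E F' k s D" "T \<subseteq> V"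
    and "\<And>j y. j < s \<Longrightarrow> y \<in> T \<Longrightarrow> y # D j \<in> F"
    and "b / 2 * real (card V) \<le> 2 ^ (q * s) * real (card T)"
proof -
  let ?n = "real (card V)"
  define N where "N xs = {y \<in> V. y # xs \<in> F}" for xs
  define F' where "F' = {xs \<in> clique_lists E V k. b * ?n \<le> real (card (N xs))}"
  let ?L = "{xs. set xs \<subseteq> V \<and> length xs = k}"
  have finF': "finite F'" using finite_clique_lists[OF assms(1)] by (simp add: F'_def)
  have finL: "finite ?L" "card ?L = card V ^ k"
    using finite_lists_length_eq[OF assms(1)] card_lists_length_eq[OF assms(1)] by auto
  have F'L: "F' \<subseteq> ?L" by (auto simp: F'_def clique_lists_def)
  have finN: "finite (N xs)" for xs using assms(1) by (simp add: N_def)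
  have "card F \<le> card ((\<lambda>(xs, y). y # xs) ` (SIGMA xs:?L. N xs))"
  proof (rule card_mono)
    show "F \<subseteq> (\<lambda>(xs, y). y # xs) ` (SIGMA xs:?L. N xs)"
    proof
      fix zs assume zs: "zs \<in> F"
      then have "length zs = Suc k" "set zs \<subseteq> V" using assms(3) by (auto simp: clique_lists_def)
      then obtain y xs where "zs = y # xs" "length xs = k" "y \<in> V" "set xs \<subseteq> V"
        by (cases zs) auto
      then show "zs \<in> (\<lambda>(xs, y). y # xs) ` (SIGMA xs:?L. N xs)"
        using zs by (auto simp: N_def image_iff)
    qed
  qed (use finL finN in auto)
  also have "\<dots> \<le> card (SIGMA xs:?L. N xs)" using finL finN by (intro card_image_le) auto
  also have "\<dots> = (\<Sum>xs\<in>?L. card (N xs))" using finL finN by simp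
  finally have "real (card F) \<le> (\<Sum>xs\<in>?L. real (card (N xs)))" by (metis of_nat_le_iff of_nat_sum)
  also have "\<dots> \<le> (\<Sum>xs\<in>?L. b * ?n + (if xs \<in> F' then ?n else 0))"
  proof (rule sum_mono)
    fix xs assume xs: "xs \<in> ?L"
    show "real (card (N xs)) \<le> b * ?n + (if xs \<in> F' then ?n else 0)"
    proof (cases "xs \<in> F'")
      case True
      have "card (N xs) \<le> card V" using assms(1) by (intro card_mono) (auto simp: N_def)
      then have "real (card (N xs)) \<le> ?n" by simp
      moreover have "0 \<le> b * ?n" using assms(5) by simp
      ultimately show ?thesis using True by simp
    next
      case False
      show ?thesis
      proof (cases "N xs = {}")
        case True
        then show ?thesis using False assms(5) by simp
      next
        \<comment> \<open>Some \<open>y # xs\<close> lies in \<open>F\<close>, so \<open>xs\<close>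
          is itself an ordered clique and can be outside \<open>F'\<close> only by having few
          heads.\<close>
        case ne: False
        then have "xs \<in> clique_lists E V k"
          using assms(3) xs by (auto simp: N_def clique_lists_def)
        then show ?thesis using False by (simp add: F'_def)
      qed
    qed
  qed
  also have "\<dots> = ?n ^ k * (b * ?n) + real (card F') * ?n"
  proof -
    have "?L \<inter> {x. x \<in> F'} = F'" using F'L by auto
    then show ?thesis using finL by (simp add: sum.distrib sum.If_cases)
  qed
  finally have "real (Suc k) * b * ?n ^ Suc k \<le> ?n ^ k * (b * ?n) + real (card F') * ?n"
    using dense by linarith
  then have "?n * (real k * b * ?n ^ k) \<le> ?n * real (card F')"
    by (simp add: algebra_simps)
  moreover have npos: "?n > 0" using assms(1,2) by (simp add: card_gt_0_iff)
  ultimately have "real k * b * ?n ^ k \<le> real (card F')" by simp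
  then obtain D where D: "blow_up E F' k (q * s) D"
    using IH[of F'] by (auto simp: F'_def)
  have q0: "q > 0" using assms(5,6) by (cases q) auto
  obtain S where S: "S \<subseteq> {..<q * s}" "card S = s"
    and T: "b / 2 * ?n \<le> 2 ^ (q * s) * real (card {y \<in> V. \<forall>j\<in>S. y \<in> N (D j)})"
  proof (rule exists_common_block[OF assms(1), of "q * s" "\<lambda>j. N (D j)" b s])
    fix j assume "j < q * s"
    then have "D j \<in> F'" using D by (simp add: blow_up_def)
    then show "b * ?n \<le> real (card (N (D j)))" "N (D j) \<subseteq> V" by (auto simp: F'_def N_def)
  next
    have "2 * real s \<le> real q * b * real s" using assms(6) by (intro mult_right_mono) auto
    then show "2 * real s \<le> b * real (q * s)" by (simp add: mult_ac)
  qed (use assms q0 in auto)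
  obtain h where h: "bij_betw h {..<s} S"
    using S finite_subset[OF S(1)] ex_bij_betw_nat_finite[of S] by (auto simp: lessThan_atLeast0)
  show thesis
  proof (rule that[of F' "D \<circ> h" "{y \<in> V. \<forall>j\<in>S. y \<in> N (D j)}"])
    show "blow_up E F' k s (D \<circ> h)"
      using D h S(1) by (intro blow_up_comp) (auto simp: bij_betw_def)
    show "y # (D \<circ> h) j \<in> F" if "j < s" "y \<in> {y \<in> V. \<forall>j\<in>S. y \<in> N (D j)}" for j y
      using that bij_betwE[OF h] by (auto simp: N_def)
  qed (use T in \<open>auto simp: F'_def\<close>)
qed

text \<open>Each recursion level asks for \<open>q\<close> times as many rows of lists one entry
  shorter. Passing from \<open>(Suc k, s)\<close> to \<open>(k, q * s)\<close> leaves
  \<open>M\<close> unchanged, so a single size condition in terms of \<open>M\<close> covers all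
  levels.\<close>

lemma exists_blow_up:
  fixes b :: real and q k :: nat
  assumes "finite V" "symp E" "b > 0" "2 \<le> real q * b" "k > 0"
    and "F \<subseteq> clique_lists E V k"
    and "real k * b * real (card V) ^ k \<le> real (card F)"
    and "s > 0" "M = q ^ (k - 1) * s" "2 ^ M * real M \<le> b / 2 * real (card V)"
  shows "\<exists>D. blow_up E F k s D"
  using assms(5-10)
proof (induction k arbitrary: F s rule: nat_induct_non_zero)
  case 1
  have "1 * real s \<le> 2 ^ s * real s" by (intro mult_right_mono) auto
  also have "\<dots> \<le> b / 2 * real (card V)" using 1 by simp
  also have "\<dots> \<le> b * real (card V)" using assms(3) by simp
  also have "\<dots> \<le> real (card F)" using 1 by simp
  finally have "s \<le> card F" by simp
  then obtain S where S: "S \<subseteq> F" "card S = s" "finite S" by (meson obtain_subset_with_card_n)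
  then obtain h where h: "bij_betw h {..<s} S"
    using ex_bij_betw_nat_finite[of S] by (auto simp: lessThan_atLeast0)
  have "inj_on (\<lambda>j. h j ! 0) {..<s}"
  proof (rule inj_onI)
    fix i j assume ij: "i \<in> {..<s}" "j \<in> {..<s}" "h i ! 0 = h j ! 0"
    then have "length (h i) = 1" "length (h j) = 1"
      using bij_betwE[OF h] S(1) 1(1) by (auto simp: clique_lists_def)
    then have "h i = h j" using ij(3) by (metis length_0_conv length_Suc_conv One_nat_def nth_Cons_0)
    then show "i = j" using ij h by (auto simp: bij_betw_def inj_on_def)
  qed
  then show ?case using bij_betwE[OF h] S(1) by (intro exI[of _ h]) (auto simp: blow_up_def)
next
  case (Suc k)
  have q0: "q \<ge> 1" using assms(3,4) by (cases q) auto
  have M: "M = q ^ (k - 1) * (q * s)"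
    using Suc.hyps Suc.prems(4) by (cases k) (auto simp: mult_ac)
  have Mpos: "0 < M" using Suc.prems(3,4) q0 by simp
  have "V \<noteq> {}"
  proof
    assume "V = {}"
    moreover have "0 < 2 ^ M * real M" using Mpos by simp
    ultimately show False using Suc.prems(5) by simp
  qed
  have IH: "\<exists>D. blow_up E F' k (q * s) D"
    if "F' \<subseteq> clique_lists E V k" "real k * b * real (card V) ^ k \<le> real (card F')" for F'
    using that Suc.prems(3,5) q0 by (intro Suc.IH M) auto
  obtain F' D T where F': "F' \<subseteq> clique_lists E V k" and D: "blow_up E F' k s D" and TV: "T \<subseteq> V"
    and DT: "\<And>j y. j < s \<Longrightarrow> y \<in> T \<Longrightarrow> y # D j \<in> F"
    and T: "b / 2 * real (card V) \<le> 2 ^ (q * s) * real (card T)"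
    using blow_up_extend[OF assms(1) \<open>V \<noteq> {}\<close> Suc.prems(1,2) assms(3,4) Suc.prems(3) IH] by blast
  have "s \<le> card T"
  proof -
    have qs: "q * s \<le> M" "s \<le> M" unfolding M using q0 by auto
    have "2 ^ (q * s) * real s \<le> 2 ^ M * real M"
      using qs by (intro mult_mono power_increasing) auto
    also have "\<dots> \<le> 2 ^ (q * s) * real (card T)" using T Suc.prems(5) by linarith
    finally show ?thesis by simp
  qed
  then obtain S where S: "S \<subseteq> T" "card S = s" "finite S" by (meson obtain_subset_with_card_n)
  then obtain h where h: "bij_betw h {..<s} S"
    using ex_bij_betw_nat_finite[of S] by (auto simp: lessThan_atLeast0)
  have hT: "h j \<in> T" if "j < s" for j using bij_betwE[OF h] S(1) that by auto
  define D' where "D' j = h j # D j" for j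
  have len: "length (D j) = k" if "j < s" for j
    using D F' that by (auto simp: blow_up_def clique_lists_def)
  \<comment> \<open>Every element of \<open>T\<close> extends every row, which gives the adjacencies
    between different rows \<open>i\<close> and \<open>j\<close>.\<close>
  have hD: "E (h i) (D j ! p)" if "i < s" "j < s" "p < k" for i j p
  proof -
    have "sorted_wrt E (h i # D j)"
      using DT[OF that(2) hT[OF that(1)]] Suc.prems(1) by (auto simp: clique_lists_def)
    then show ?thesis using len[OF that(2)] that(3) by simp
  qed
  have "blow_up E F (Suc k) s D'"
    unfolding blow_up_def
  proof (intro conjI allI impI)
    show "D' j \<in> F" if "j < s" for j using DT[OF that hT[OF that]] by (simp add: D'_def)
    show "inj_on (\<lambda>j. D' j ! p) {..<s}" if "p < Suc k" for p
      using that D h by (cases p) (auto simp: D'_def blow_up_def bij_betw_def)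
    show "E (D' i ! p) (D' j ! p')" if "i < s" "j < s" "p < Suc k" "p' < Suc k" "p \<noteq> p'" for i j p p'
      using that D hD sympD[OF assms(2)]
      by (cases p; cases p') (auto simp: D'_def blow_up_def)
  qed
  then show ?case by blast
qed

section \<open>Embedding\<close>

lemma contains_copyI:
  assumes "simple_graph G" "simple_graph H" "inj_on f (verts H)" "f ` verts H \<subseteq> verts G"
    and "\<And>e. e \<in> edges H \<Longrightarrow> f ` e \<in> edges G"
  shows "contains_copy G H"
proof -
  let ?H' = "(f ` verts H, (image f) ` edges H)"
  have sub: "e \<subseteq> verts H" if "e \<in> edges H" for e
    using assms(2) that by (auto simp: simple_graph_def)
  have "subgraph_of ?H' G"
    unfolding subgraph_of_def simple_graph_def
  proof (intro conjI ballI)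
    show "finite (verts ?H')" using assms(2) by (simp add: simple_graph_def)
    fix e' assume "e' \<in> edges ?H'"
    then obtain e where e: "e \<in> edges H" "e' = f ` e" by auto
    show "e' \<subseteq> verts ?H'" using e sub by auto
    show "card e' = 2"
      using assms(1) assms(5)[OF e(1)] e(2) by (simp add: simple_graph_def)
  qed (use assms in auto)
  moreover have "graph_isomorphic H ?H'"
    unfolding graph_isomorphic_def
  proof (intro exI[of _ f] conjI ballI)
    show "bij_betw f (verts H) (verts ?H')" using assms(3) by (simp add: bij_betw_def)
    fix x y assume xy: "x \<in> verts H" "y \<in> verts H"
    show "{x, y} \<in> edges H \<longleftrightarrow> {f x, f y} \<in> edges ?H'"
    proof
      assume "{f x, f y} \<in> edges ?H'"
      then obtain e where e: "e \<in> edges H" "f ` {x, y} = f ` e" by auto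
      then have "{x, y} = e"
        using inj_on_image_eq_iff[OF assms(3), of "{x, y}" e] sub[OF e(1)] xy by auto
      then show "{x, y} \<in> edges H" using e(1) by simp
    next
      assume "{x, y} \<in> edges H"
      then have "f ` {x, y} \<in> edges ?H'" unfolding snd_conv by (rule imageI)
      then show "{f x, f y} \<in> edges ?H'" by simp
    qed
  qed
  ultimately show ?thesis unfolding contains_copy_def by blast
qed

text \<open>Injectivity is asked only within each part; vertices of different parts are adjacent,
  hence distinct, as there are no loops.\<close>

lemma contains_K_plusI:
  fixes G :: "'a sgraph" and f :: "nat \<Rightarrow> nat \<Rightarrow> 'a"
  assumes "simple_graph G" "r \<ge> 1" "s 0 \<ge> 2"
    and verts: "\<And>i j. i < r \<Longrightarrow> j < s i \<Longrightarrow> f i j \<in> verts G"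
    and inj: "\<And>i. i < r \<Longrightarrow> inj_on (f i) {..<s i}"
    and adj: "\<And>i i' j j'. i < i' \<Longrightarrow> i' < r \<Longrightarrow> j < s i \<Longrightarrow> j' < s i' \<Longrightarrow> {f i j, f i' j'} \<in> edges G"
    and extra: "{f 0 0, f 0 1} \<in> edges G"
  shows "contains_copy G (K_plus r s)"
proof -
  let ?V = "SIGMA i:{..<r}. {..<s i}"
  have adj': "{f i j, f i' j'} \<in> edges G"
    if "i \<noteq> i'" "i < r" "i' < r" "j < s i" "j' < s i'" for i i' j j'
    using that adj[of i i' j j'] adj[of i' i j' j] by (cases "i < i'") (auto simp: insert_commute)
  have V: "verts (K_plus r s) = ?V"
    by (simp add: K_plus_def complete_multipartite_def Let_def)
  have loop: "{x, x} \<notin> edges G" for x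
    using assms(1) by (auto simp: simple_graph_def)
  show ?thesis
  proof (rule contains_copyI[OF assms(1) simple_graph_K_plus[where s = s, OF assms(2,3)],
        of "\<lambda>(i, j). f i j"])
    show "inj_on (\<lambda>(i, j). f i j) (verts (K_plus r s))"
      unfolding V
    proof (rule inj_onI, clarify)
      fix i j i' j' assume *: "i < r" "j < s i" "i' < r" "j' < s i'" "f i j = f i' j'"
      have "i = i'"
        using adj'[of i i' j j'] loop[of "f i j"] * by auto
      then show "i = i' \<and> j = j'" using * inj[of i] by (auto simp: inj_on_def)
    qed
    show "(\<lambda>(i, j). f i j) ` verts (K_plus r s) \<subseteq> verts G"
      unfolding V using verts by auto
    fix e assume "e \<in> edges (K_plus r s)"
    then consider "e = {(0, 0), (0, 1)}"
      | x y where "e = {x, y}" "x \<in> ?V" "y \<in> ?V" "fst x \<noteq> fst y"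
      unfolding K_plus_def complete_multipartite_def Let_def snd_conv fst_conv by blast
    then show "(\<lambda>(i, j). f i j) ` e \<in> edges G"
    proof cases
      case 1
      then show ?thesis using extra by simp
    next
      case 2
      then show ?thesis using adj' by (auto simp: split_def)
    qed
  qed
qed

text \<open>The columns of \<open>D\<close> are parts, and \<open>T\<close> supplies the last one.
  The final column is the one not known to be joined to \<open>u\<close> and \<open>v\<close>, so
  these join that column: inside a part no adjacency is required, and all other columns and
  \<open>T\<close> are covered by \<open>joint\<close>.\<close>

lemma contains_K_plus_of_blow_up:
  fixes G :: "'a sgraph" and r s t :: nat and D :: "nat \<Rightarrow> 'a list"
  defines "E \<equiv> \<lambda>x y. {x, y} \<in> edges G"
  assumes "simple_graph G" "r \<ge> 2" "s \<ge> 2" "t > 0" "t \<le> card T" "T \<subseteq> verts G"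
    and D: "blow_up E F' (r - 1) s D" and F': "F' \<subseteq> clique_lists E (verts G) (r - 1)"
    and DT: "\<And>j y. j < s \<Longrightarrow> y \<in> T \<Longrightarrow> y # D j \<in> F" and F: "F \<subseteq> clique_lists E (verts G) r"
    and uv: "u \<in> verts G" "v \<in> verts G" "u \<noteq> v" "E u v"
    and joint: "\<And>xs x. xs \<in> F \<Longrightarrow> x \<in> set (butlast xs) \<Longrightarrow> E u x \<and> E v x"
  shows "contains_copy G (K_plus r (\<lambda>i. if i < r - 1 then s else t))"
proof -
  define a where "a j = D j ! (r - 2)" for j
  have "inj_on a {..<s}" using D assms(3) by (simp add: blow_up_def a_def[abs_def])
  then have "card (a ` {..<s}) = s" by (simp add: card_image)
  \<comment> \<open>\<open>u\<close> and \<open>v\<close> may themselves occur in the final column;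
    removing them still leaves the \<open>s - 2\<close> vertices needed.\<close>
  then have "s - 2 \<le> card (a ` {..<s} - {u, v})"
    using diff_card_le_card_Diff[of "{u, v}" "a ` {..<s}"] uv(3) by simp
  then obtain B where B: "B \<subseteq> a ` {..<s} - {u, v}" "card B = s - 2" "finite B"
    by (meson obtain_subset_with_card_n)
  then obtain h where h: "bij_betw h {..<s - 2} B"
    using ex_bij_betw_nat_finite[of B] by (auto simp: lessThan_atLeast0)
  obtain T' where T': "T' \<subseteq> T" "card T' = t" "finite T'"
    using assms(6) by (meson obtain_subset_with_card_n)
  then obtain w where w: "bij_betw w {..<t} T'"
    using ex_bij_betw_nat_finite[of T'] by (auto simp: lessThan_atLeast0)
  define g where "g j = (if j = 0 then u else if j = 1 then v else h (j - 2))" for j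
  have hB: "h (j - 2) \<in> B" if "2 \<le> j" "j < s" for j using bij_betwE[OF h] that by auto
  have g: "g j = u \<or> g j = v \<or> (\<exists>i<s. g j = a i)" if "j < s" for j
  proof (cases "j \<ge> 2")
    case True
    then have "g j \<in> B" using hB[OF True that] by (simp add: g_def)
    then show ?thesis using B(1) by auto
  next
    case False
    then have "j = 0 \<or> j = 1" by linarith
    then show ?thesis by (auto simp: g_def)
  qed
  have ginj: "inj_on g {..<s}"
  proof (rule inj_onI)
    fix i j assume ij: "i \<in> {..<s}" "j \<in> {..<s}" "g i = g j"
    have hinj: "i - 2 = j - 2" if "2 \<le> i" "2 \<le> j" "h (i - 2) = h (j - 2)"
      using h ij that by (auto simp: bij_betw_def inj_on_def)
    have hne: "h (k - 2) \<noteq> u \<and> h (k - 2) \<noteq> v" if "2 \<le> k" "k < s" for k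
      using hB[OF that] B(1) by auto
    have g2: "g k = h (k - 2)" if "2 \<le> k" for k using that by (simp add: g_def)
    have g1: "g k = (if k = 0 then u else v)" if "\<not> 2 \<le> k" for k using that by (auto simp: g_def)
    show "i = j"
    proof (cases "2 \<le> i"; cases "2 \<le> j")
      assume "2 \<le> i" "2 \<le> j"
      then show ?thesis using hinj ij(3) by (simp add: g2)
    next
      assume "2 \<le> i" "\<not> 2 \<le> j"
      then show ?thesis using hne[of i] ij by (auto simp: g1 g2 split: if_splits)
    next
      assume "\<not> 2 \<le> i" "2 \<le> j"
      then show ?thesis using hne[of j] ij by (auto simp: g1 g2 split: if_splits)
    next
      assume "\<not> 2 \<le> i" "\<not> 2 \<le> j"
      then show ?thesis using ij(3) uv(3) by (auto simp: g1 split: if_splits)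
    qed
  qed
  have wT: "w j \<in> T" if "j < t" for j using bij_betwE[OF w] T'(1) that by auto
  have Dl: "length (D j) = r - 1" "set (D j) \<subseteq> verts G" if "j < s" for j
    using D F' that by (auto simp: blow_up_def clique_lists_def)
  have Dv: "D j ! p \<in> verts G" if "j < s" "p < r - 1" for j p
    using Dl[OF that(1)] that(2) by (auto dest: nth_mem)
  have DD: "E (D i ! p) (D j ! p')" if "i < s" "j < s" "p < r - 1" "p' < r - 1" "p \<noteq> p'" for i j p p'
    using D that by (simp add: blow_up_def)
  have sym: "E x y \<Longrightarrow> E y x" for x y by (simp add: E_def insert_commute)
  have wD: "E (D j ! p) (w i)" if "i < t" "j < s" "p < r - 1" for i j p
  proof -
    have "sorted_wrt E (w i # D j)"
      using DT[OF that(2) wT[OF that(1)]] F by (auto simp: clique_lists_def)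
    then show ?thesis using Dl[OF that(2)] that(3) by (auto intro: sym)
  qed
  have jw: "E u (w i) \<and> E v (w i)" if "i < t" for i
  proof -
    have "D 0 \<noteq> []" using Dl(1)[of 0] assms(3,4) by auto
    then show ?thesis
      using DT[OF _ wT[OF that], of 0] assms(4) by (intro joint[of "w i # D 0"]) auto
  qed
  have jD: "E u (D j ! p) \<and> E v (D j ! p)" if "j < s" "p < r - 2" for j p
  proof (rule joint[OF DT[OF that(1) wT]])
    show "0 < t" by (rule assms(5))
    have "D j \<noteq> []" using Dl(1)[OF that(1)] that(2) by auto
    moreover have "D j ! p = butlast (D j) ! p" "p < length (butlast (D j))"
      using Dl(1)[OF that(1)] that(2) by (auto simp: nth_butlast)
    ultimately show "D j ! p \<in> set (butlast (w 0 # D j))" by (auto simp: in_set_conv_nth)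
  qed
  \<comment> \<open>The columns are taken in reverse, so that column \<open>r - 2\<close>, modified
    to \<open>g\<close>, is part \<open>0\<close> and carries the extra edge. For
    \<open>r = 2\<close> there are no middle parts.\<close>
  define f where "f i = (if i = 0 then g else if i < r - 1 then (\<lambda>j. D j ! (r - 2 - i)) else w)" for i
  have f0: "f 0 = g" by (simp add: f_def)
  have fl: "f i = w" if "i = r - 1" for i using that assms(3) by (auto simp: f_def)
  have fm: "f i = (\<lambda>j. D j ! (r - 2 - i))" if "0 < i" "i < r - 1" for i
    using that by (simp add: f_def)
  have cases3: "i = 0 \<or> 0 < i \<and> i < r - 1 \<or> i = r - 1" if "i < r" for i
    using that by linarith
  show ?thesis
  proof (rule contains_K_plusI[OF assms(2), where f = f])
    show "1 \<le> r" "2 \<le> (if 0 < r - 1 then s else t)" using assms(3,4) by auto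
  next
    fix i j assume ij: "i < r" "j < (if i < r - 1 then s else t)"
    consider "i = 0" | "0 < i" "i < r - 1" | "i = r - 1" using cases3[OF ij(1)] by blast
    then show "f i j \<in> verts G"
    proof cases
      case 1
      then have "j < s" using ij assms(3) by auto
      then show ?thesis unfolding 1 f0 using g[of j] uv(1,2) Dv assms(3) by (auto simp: a_def)
    next
      case 2
      then show ?thesis using ij Dv by (auto simp: fm)
    next
      case 3
      then show ?thesis using ij wT assms(7) by (auto simp: fl)
    qed
  next
    fix i assume ir: "i < r"
    consider "i = 0" | "0 < i" "i < r - 1" | "i = r - 1" using cases3[OF ir] by blast
    then show "inj_on (f i) {..<if i < r - 1 then s else t}"
    proof cases
      case 1
      then show ?thesis using f0 ginj assms(3) by auto
    next
      case 2
      then show ?thesis using D by (auto simp: fm blow_up_def)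
    next
      case 3
      then show ?thesis using w by (auto simp: fl bij_betw_def)
    qed
  next
    fix i i' j j'
    assume *: "i < i'" "i' < r" "j < (if i < r - 1 then s else t)" "j' < (if i' < r - 1 then s else t)"
    have js: "j < s" using * by (auto split: if_splits)
    consider "i' < r - 1" | "i' = r - 1" using *(2) by linarith
    then have "E (f i j) (f i' j')"
    proof cases
      case 1
      then have j's: "j' < s" and p': "r - 2 - i' < r - 2" using * by auto
      show ?thesis
      proof (cases "i = 0")
        case True
        have "E (a k) (D j' ! (r - 2 - i'))" if "k < s" for k
          unfolding a_def using that j's p' by (intro DD) auto
        then show ?thesis
          using g[OF js] jD[OF j's p'] 1 *(1) by (auto simp: True f0 fm)
      next
        case False
        then have "f i j = D j ! (r - 2 - i)" "f i' j' = D j' ! (r - 2 - i')"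
          using * 1 by (simp_all add: fm)
        then show ?thesis using js j's 1 * False by (auto intro!: DD)
      qed
    next
      case 2
      then have j't: "j' < t" using * by auto
      show ?thesis
      proof (cases "i = 0")
        case True
        have "E (a k) (w j')" if "k < s" for k
          unfolding a_def using that j't assms(3) by (intro wD) auto
        then show ?thesis
          using g[OF js] jw[OF j't] by (auto simp: True f0 fl[OF 2])
      next
        case False
        then show ?thesis using js j't *(1) 2 wD by (auto simp: fm fl)
      qed
    qed
    then show "{f i j, f i' j'} \<in> edges G" by (simp add: E_def)
  next
    show "{f 0 0, f 0 1} \<in> edges G" using uv(4) by (simp add: f0 g_def E_def)
  qed
qed

section \<open>Parameters and conclusion\<close>

lemma two_power_le_exp: "(2::real) ^ m \<le> exp (real m)"
proof -
  have "(2::real) ^ m \<le> exp 1 ^ m" using exp_ge_add_one_self[of 1] by (intro power_mono) auto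
  then show ?thesis by (simp flip: exp_of_nat_mult)
qed

text \<open>The bounds on \<open>c\<close> give \<open>2 \<le> c * ln n\<close> and
  \<open>c * r ^ e \<le> 1\<close> for \<open>e = (r + 7) * (r + 1)\<close>, hence
  \<open>2 * r ^ e \<le> ln n\<close>. The conclusions serve, in order, the dense core, the blow-up
  of the tails and the size of the last part, with \<open>x\<close> for \<open>card U\<close> and
  \<open>y\<close> for \<open>card T\<close>.\<close>

lemma size_estimates:
  fixes r n s :: nat and c :: real
  assumes "r \<ge> 2" "n > 1"
    and c: "2 / ln (real n) \<le> c" "c \<le> 1 / real r ^ ((r + 7) * (r + 1))"
    and s: "real s \<le> c * ln (real n)"
  defines "q \<equiv> r ^ (r + 8)"
  shows "16 * real r ^ 3 \<le> real n"
    and "real n \<le> 4 * real r * x \<Longrightarrow>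
           2 ^ (q ^ (r - 2) * (q * s)) * real (q ^ (r - 2) * (q * s)) \<le> 2 / real q / 2 * x"
    and "real n \<le> 4 * real r * x \<Longrightarrow> 2 / real q / 2 * x \<le> 2 ^ (q * s) * y \<Longrightarrow>
           real n powr (1 - sqrt c) \<le> y"
proof -
  define L R e w where "L = ln (real n)" and "R = real r" and "e = (r + 7) * (r + 1)" and "w = sqrt c"
  have L0: "L > 0" using assms(2) by (simp add: L_def)
  have n: "real n = exp L" using assms(2) by (simp add: L_def)
  have R: "R \<ge> 2" using assms(1) by (simp add: R_def)
  have Re: "R ^ e > 0" using R by simp
  have c0: "c > 0" using c(1) L0 less_le_trans[of 0 "2 / L" c] by (simp add: L_def)
  have cL: "2 \<le> c * L" using c(1) L0 by (simp add: L_def divide_le_eq)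
  have cR: "c * R ^ e \<le> 1" using c(2) Re by (simp add: R_def e_def le_divide_eq)
  have sL: "real s \<le> c * L" using s by (simp add: L_def)
  obtain k where k: "r = k + 2" using assms(1) le_Suc_ex by (metis add.commute)
  have pw: "R ^ m \<le> R ^ e" if "m \<le> e" for m using that R by (intro power_increasing) auto
  have pc: "c * R ^ m \<le> 1" if "m \<le> e" for m
    using mult_left_mono[OF pw[OF that], of c] c0 cR by linarith
  have LR: "2 * R ^ e \<le> L"
  proof -
    have "R ^ e * 2 \<le> R ^ e * (c * L)" using cL Re by (intro mult_left_mono) auto
    also have "\<dots> = (c * R ^ e) * L" by simp
    also have "\<dots> \<le> 1 * L" using cR L0 by (intro mult_right_mono) auto
    finally show ?thesis by simp
  qed
  have Q: "real q = R ^ (r + 8)" by (simp add: q_def R_def)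
  have Q0: "real q > 0" using R by (simp add: Q)
  have Q4: "4 * R * real q \<le> R ^ (r + 11)"
  proof -
    have "2 * 2 \<le> R * R" using R by (intro mult_mono) auto
    then have "4 * R ^ (r + 9) \<le> (R * R) * R ^ (r + 9)" using R by (intro mult_right_mono) auto
    moreover have "R * real q = R ^ (r + 9)" by (simp add: Q power_add eval_nat_numeral)
    moreover have "(R * R) * R ^ (r + 9) = R ^ (r + 11)" by (simp add: power_add eval_nat_numeral)
    ultimately show ?thesis by simp
  qed
  show "16 * real r ^ 3 \<le> real n"
  proof -
    have "2 ^ 3 * R ^ 3 \<le> R ^ 3 * R ^ 3" using R by (intro mult_right_mono power_mono) auto
    also have "\<dots> = R ^ 6" by (simp flip: power_add)
    also have "\<dots> \<le> R ^ e" by (rule pw) (simp add: e_def k)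
    finally have "16 * R ^ 3 \<le> L" using LR by simp
    then show ?thesis using exp_ge_add_one_self[of L] unfolding n R_def by linarith
  qed
  show "2 ^ (q ^ (r - 2) * (q * s)) * real (q ^ (r - 2) * (q * s)) \<le> 2 / real q / 2 * x"
    if x: "real n \<le> 4 * real r * x"
  proof -
    define M where "M = q ^ (r - 2) * (q * s)"
    have "real M = real q ^ (r - 1) * real s"
      by (simp add: M_def k mult_ac)
    also have "\<dots> = R ^ ((r + 8) * (r - 1)) * real s" by (simp add: Q power_mult)
    finally have M: "real M = R ^ ((r + 8) * (r - 1)) * real s" .
    \<comment> \<open>Then \<open>2 ^ M * M\<close> is at most \<open>4 ^ M\<close> and so at most
      \<open>exp (L / 2)\<close>, the square root of \<open>n\<close>; the other square root covers
      \<open>4 * R * q\<close>.\<close>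
    have "4 * real M \<le> L"
    proof -
      have "2 ^ 2 \<le> R ^ 2" using R by (intro power_mono) auto
      then have "4 * real M \<le> R ^ 2 * real M" by (intro mult_right_mono) auto
      also have "\<dots> = R ^ (2 + (r + 8) * (r - 1)) * real s"
        unfolding M by (simp add: power_add power2_eq_square)
      also have "\<dots> \<le> R ^ (2 + (r + 8) * (r - 1)) * (c * L)"
        using sL R by (intro mult_left_mono) auto
      also have "\<dots> = (c * R ^ (2 + (r + 8) * (r - 1))) * L" by simp
      also have "\<dots> \<le> 1 * L"
        using L0 by (intro mult_right_mono pc) (auto simp: e_def k algebra_simps)
      finally show ?thesis by simp
    qed
    have "2 ^ M * real M \<le> 2 ^ M * 2 ^ M"
      by (intro mult_left_mono less_imp_le of_nat_less_two_power) simp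
    also have "\<dots> \<le> exp (real M) * exp (real M)" by (intro mult_mono two_power_le_exp) auto
    also have "\<dots> = exp (2 * real M)" by (simp flip: exp_add)
    also have "\<dots> \<le> exp (L / 2)" using \<open>4 * real M \<le> L\<close> by simp
    finally have 1: "2 ^ M * real M \<le> exp (L / 2)" .
    have "4 * R * real q \<le> exp (L / 2)"
    proof -
      have "R ^ (r + 11) \<le> R ^ e" by (rule pw) (simp add: e_def k)
      then show ?thesis using Q4 LR exp_ge_add_one_self[of "L / 2"] by linarith
    qed
    then have "exp (L / 2) * (4 * R * real q) \<le> exp (L / 2) * exp (L / 2)" by simp
    also have "\<dots> = real n" by (simp add: n flip: exp_add)
    also have "\<dots> \<le> 4 * R * x" using x by (simp add: R_def)
    finally have "4 * R * (exp (L / 2) * real q) \<le> 4 * R * x" by (simp add: mult_ac)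
    then have "exp (L / 2) * real q \<le> x" using R by simp
    then have "exp (L / 2) \<le> 2 / real q / 2 * x" using Q0 by (simp add: field_simps)
    then show ?thesis using 1 unfolding M_def by linarith
  qed
  show "real n powr (1 - sqrt c) \<le> y"
    if x: "real n \<le> 4 * real r * x" and y: "2 / real q / 2 * x \<le> 2 ^ (q * s) * y"
  proof -
    have w0: "w > 0" "w * w = c" using c0 by (simp_all add: w_def)
    \<comment> \<open>Squared, this follows from \<open>c * R ^ (2 * (r + 11)) \<le> 1\<close>; at
      \<open>r = 2\<close> that exponent is \<open>26\<close>, just below \<open>e = 27\<close>.
      With \<open>cL\<close> it bounds \<open>4 * R * q\<close> and \<open>2 ^ (q * s)\<close> by
      \<open>exp (w * L / 2)\<close> each, so their product is at most
      \<open>n powr sqrt c\<close>.\<close>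
    have Qw: "4 * R * real q * w \<le> 1"
    proof -
      have "(4 * R * real q * w)\<^sup>2 = (4 * R * real q)\<^sup>2 * c"
        using w0(2) by (simp add: power2_eq_square mult_ac)
      also have "\<dots> \<le> (R ^ (r + 11))\<^sup>2 * c" using Q4 R c0 by (intro mult_right_mono power_mono) auto
      also have "\<dots> = c * R ^ ((r + 11) * 2)" by (subst power_mult) (rule mult.commute)
      also have "\<dots> \<le> 1" by (rule pc) (simp add: e_def k)
      finally have "(4 * R * real q * w)\<^sup>2 \<le> 1\<^sup>2" by simp
      then show ?thesis by (rule power2_le_imp_le) simp
    qed
    have wL: "2 \<le> w * (w * L)" using cL w0(2) by (simp add: mult.assoc[symmetric])
    have "2 * real q * w \<le> 1"
    proof -
      have "2 * (real q * w) \<le> (4 * R) * (real q * w)" using R w0 Q0 by (intro mult_right_mono) auto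
      then show ?thesis using Qw by (simp add: mult_ac)
    qed
    then have "(2 * real q * w) * (w * L) \<le> 1 * (w * L)"
      using w0 L0 by (intro mult_right_mono) auto
    then have "real q * (c * L) \<le> w * L / 2" unfolding w0(2)[symmetric] by (simp add: mult_ac)
    moreover have "real (q * s) \<le> real q * (c * L)" using sL Q0 by simp
    ultimately have "real (q * s) \<le> w * L / 2" by linarith
    then have p1: "2 ^ (q * s) \<le> exp (w * L / 2)"
      by (intro order_trans[OF two_power_le_exp]) simp
    have "4 * R * real q \<le> w * L / 2"
    proof -
      have "w * (4 * R * real q) \<le> w * (w * L / 2)" using Qw wL by (simp add: mult_ac)
      then show ?thesis using w0 by simp
    qed
    then have p2: "4 * R * real q \<le> exp (w * L / 2)" using exp_ge_add_one_self[of "w * L / 2"] by linarith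
    have y0: "0 \<le> y"
    proof -
      have "0 < 4 * R * x" using x assms(2) unfolding R_def by linarith
      then have "0 < x" using R by (simp add: zero_less_mult_iff)
      then have "0 < 2 / real q / 2 * x" using Q0 by simp
      then have "0 < 2 ^ (q * s) * y" using y by linarith
      then show ?thesis by (simp add: zero_less_mult_iff)
    qed
    have "x \<le> real q * (2 ^ (q * s) * y)" using y Q0 by (simp add: field_simps)
    then have "4 * R * x \<le> 4 * R * (real q * (2 ^ (q * s) * y))" using R by simp
    then have "exp L \<le> 4 * R * (real q * (2 ^ (q * s) * y))" using x unfolding n R_def by linarith
    also have "\<dots> = (4 * R * real q * 2 ^ (q * s)) * y" by simp
    also have "\<dots> \<le> (exp (w * L / 2) * exp (w * L / 2)) * y"
      using p1 p2 y0 by (intro mult_right_mono mult_mono) auto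
    also have "\<dots> = exp (w * L) * y" by (simp flip: exp_add)
    finally have "exp L / exp (w * L) \<le> y" by (simp add: divide_le_eq mult.commute)
    moreover have "real n powr (1 - w) = exp L / exp (w * L)"
      using assms(2) by (simp add: powr_def L_def[symmetric] left_diff_distrib exp_diff)
    ultimately show ?thesis by (simp add: w_def)
  qed
qed

theorem theorem1:
  fixes r n :: nat and c :: real and G :: "'a sgraph"
  assumes "r \<ge> 2"
    and "n > 0"
    and "2 / ln (real n) \<le> c"
    and "c \<le> 1 / real r ^ ((r + 7) * (r + 1))"
    and "simple_graph G"
    and "card (verts G) = n"
    and "card (edges G) = turan_number r n + 1"
  shows "contains_copy G
           (K_plus r (\<lambda>i. if i < r - 1 then nat \<lfloor>c * ln (real n)\<rfloor>
                          else nat \<lceil>real n powr (1 - sqrt c)\<rceil>))"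
proof -
  define E where "E = (\<lambda>x y. {x, y} \<in> edges G)"
  define s where "s = nat \<lfloor>c * ln (real n)\<rfloor>"
  define q where "q = r ^ (r + 8)"
  have fin: "finite (verts G)" using assms(5) by (simp add: simple_graph_def)
  have sym: "symp E" by (auto simp: symp_def E_def insert_commute)
  have irr: "irreflp E" using assms(5) by (auto simp: irreflp_def E_def simple_graph_def)
  have edges: "card (ordered_edges E (verts G)) = 2 * (turan_number r n + 1)"
    using card_ordered_edges_graph[OF assms(5)] assms(7) by (simp add: E_def)
  \<comment> \<open>For \<open>n = 1\<close> the lower bound on \<open>c\<close> reads
    \<open>2 / 0 = 0\<close>, so it does not exclude this case; a one-vertex graph, however, has no
    edge.\<close>
  have n1: "n > 1"
  proof (rule ccontr)
    assume "\<not> n > 1"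
    then have "card (verts G) = 1" using assms(2,6) by simp
    then obtain x where x: "verts G = {x}" by (rule card_1_singletonE)
    then have "ordered_edges E (verts G) = {}"
      using irr by (auto simp: ordered_edges_def irreflp_def)
    then show False using edges by simp
  qed
  then have L: "ln (real n) > 0" by simp
  have cL: "2 \<le> c * ln (real n)" using assms(3) L by (simp add: divide_le_eq)
  have s: "real s \<le> c * ln (real n)" "s \<ge> 2"
    using cL by (auto simp: s_def le_nat_iff le_floor_iff)
  note est = size_estimates[OF assms(1) n1 assms(3,4) s(1), folded q_def]
  obtain U K where U: "U \<subseteq> verts G" "real n \<le> 4 * real r * real (card U)"
    and deg: "\<And>v. v \<in> U \<Longrightarrow>
           real (card {x \<in> U. \<not> E v x}) \<le> (1 / real r + 1 / (4 * (real r)\<^sup>2)) * real (card U)"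
    and K: "K \<subseteq> U" "card K = r + 1" "clique E K"
    using exists_dense_core[OF fin sym irr assms(1,6) edges est(1)] by blast
  have finU: "finite U" using U(1) fin finite_subset by blast
  obtain u v F where uv: "u \<in> U" "v \<in> U" "u \<noteq> v" "E u v" and F: "F \<subseteq> clique_lists E U r"
    and joint: "\<And>xs x. xs \<in> F \<Longrightarrow> x \<in> set (butlast xs) \<Longrightarrow> E u x \<and> E v x"
    and cF: "real r * (2 / real r ^ (r + 8)) * real (card U) ^ r \<le> real (card F)"
    using exists_edge_with_many_cliques[OF finU sym assms(1) deg K] by blast
  obtain k where k: "r = Suc k" "k > 0" using assms(1) by (cases r) auto
  have q0: "q > 0" using assms(1) by (simp add: q_def)
  \<comment> \<open>This is the coefficient \<open>2 / r ^ (r + 8)\<close> of \<open>cF\<close>, and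
    \<open>q * b = 2\<close> is just what \<open>blow_up_extend\<close> demands.\<close>
  define b where "b = 2 / real q"
  have b: "b > 0" "2 \<le> real q * b" using q0 by (simp_all add: b_def)
  have "U \<noteq> {}" using uv by auto
  \<comment> \<open>Only the tails, of length \<open>k = r - 1\<close>, are blown up recursively.
    The heads are added by \<open>blow_up_extend\<close> directly, which keeps the whole of
    \<open>T\<close>.\<close>
  have IH: "\<exists>D. blow_up E F' k (q * s) D"
    if "F' \<subseteq> clique_lists E U k" "real k * b * real (card U) ^ k \<le> real (card F')" for F'
  proof (rule exists_blow_up[OF finU sym b k(2) that])
    show "0 < q * s" using q0 s(2) by simp
    show "2 ^ (q ^ (k - 1) * (q * s)) * real (q ^ (k - 1) * (q * s)) \<le> b / 2 * real (card U)"
      using est(2)[OF U(2)] by (simp add: k b_def)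
  qed simp
  have dense: "real (Suc k) * b * real (card U) ^ Suc k \<le> real (card F)"
    using cF unfolding b_def q_def k(1) by simp
  have "s > 0" using s(2) by simp
  obtain F' D T where F': "F' \<subseteq> clique_lists E U k" and D: "blow_up E F' k s D" and T: "T \<subseteq> U"
    and DT: "\<And>j y. j < s \<Longrightarrow> y \<in> T \<Longrightarrow> y # D j \<in> F"
    and cT: "b / 2 * real (card U) \<le> 2 ^ (q * s) * real (card T)"
    using blow_up_extend[OF finU \<open>U \<noteq> {}\<close> F[unfolded k(1)] dense b \<open>s > 0\<close> IH] by blast
  have "real n powr (1 - sqrt c) \<le> real (card T)"
    using est(3)[OF U(2)] cT unfolding b_def by blast
  then have t: "nat \<lceil>real n powr (1 - sqrt c)\<rceil> \<le> card T" by (simp add: ceiling_le_iff)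
  have t0: "0 < nat \<lceil>real n powr (1 - sqrt c)\<rceil>" using assms(2) by simp
  have mono: "clique_lists E U m \<subseteq> clique_lists E (verts G) m" for m
    using U(1) by (auto simp: clique_lists_def)
  have "contains_copy G (K_plus r (\<lambda>i. if i < r - 1 then s else nat \<lceil>real n powr (1 - sqrt c)\<rceil>))"
  proof (rule contains_K_plus_of_blow_up[OF assms(5,1) s(2) t0 t])
    show "T \<subseteq> verts G" "u \<in> verts G" "v \<in> verts G" using T U(1) uv by auto
    show "blow_up (\<lambda>x y. {x, y} \<in> edges G) F' (r - 1) s D" using D by (simp add: k E_def)
    show "F' \<subseteq> clique_lists (\<lambda>x y. {x, y} \<in> edges G) (verts G) (r - 1)"
      using F' mono[of k] by (simp add: k E_def)
    show "F \<subseteq> clique_lists (\<lambda>x y. {x, y} \<in> edges G) (verts G) r"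
      using F mono[of r] by (simp add: E_def)
  qed (use uv DT joint in \<open>auto simp: E_def\<close>)
  then show ?thesis unfolding s_def .
qed

end
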